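(* Let $m\ge 1$ and let $a_1(x),\dots,a_m(x)$ be given functions, differentiable and integrable to the required degree. The linear ordinary differential equation $$\frac{d^m}{dx^m}Y=\sum_{p=1}^{m}a_p(x)\frac{d^{m-p}}{dx^{m-p}}Y$$ has the general solution $Y=\sum_{i=1}^{m}C_iY_{m,i}(x)$, where $C_1,\dots,C_m$ are arbitrary constants and $$Y_{m,i}(x)=\frac{(-1)^i(1-\alpha_m(-1))x^{i-1}}{(i-1)!}+\sum_{k=2}^{i}\frac{(-1)^{k+i}\alpha_m(-k)x^{i-k}}{(i-k)!},\qquad i=1,\dots,m,$$ with $$\alpha_m(-n)=\sum_{s=0}^{\infty}\xi_{m,s}(-n),\qquad n=1,\dots,m,$$ where the functions $\xi_{m,s}(-n)$ ($s=0,1,2,\dots$, $n=1,\dots,m$) are defined recursively by $$\xi_{m,s}(-n)=T_s(n;1)-\sum_{z=1}^{s}\sum_{j=1}^{m}T_{z-1}(n;j)\,\xi_{m,s-z}(-j)$$ (so $\xi_{m,0}(-n)=T_0(n;1)$), the functions $T_r(n;j)$ being defined in the context.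
   Context: $[f]_q$ denotes the $q$-fold iterated antiderivative of $f$ ($[f]_0=f$, $[f]_{q+1}=\int [f]_q\,dx$), with a fixed choice of antiderivative. $C(n,i)$ denotes the (generalized) binomial coefficient, so $C(-n,i)=(-1)^iC(n+i-1,i)$. Put $$b_k(x)=\sum_{i=1}^{k}(-1)^iC(m-i,m-k)\frac{d^{k-i}}{dx^{k-i}}a_i(x),\qquad k=1,\dots,m.$$ For integers $r\ge 0$, $n\ge1$, $1\le j\le m$ define $$T_r(n;j)=\sum_{\substack{i_0,\dots,i_r\ge 0\\ i_0+\cdots+i_r\le m-j}}(-1)^{i_0+\cdots+i_{r-1}}C(-n,i_r)\sum_{k_0=1}^{m}\cdots\sum_{k_{r-1}=1}^{m}\Bigl(\prod_{l=0}^{r-1}C(k_l-1+i_l,k_l-1)\Bigr)\bigl[B_r\bigr]_{n+i_r},$$ where $B_0=b_{j+i_0+\cdots+i_r}$ and $B_{l+1}=[B_l]_{i_l+k_l}\,b_{k_l}$ for $l=0,\dots,r-1$. For $r=0$ this reads $T_0(n;j)=\sum_{i_0=0}^{m-j}C(-n,i_0)[b_{j+i_0}]_{n+i_0}$.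
   Formalization: The fixed choice of antiderivative is taken to be integration from one arbitrary base point c of the open interval; for an arbitrary choice the claim fails (m=1, a_1=-1, ∫f := ∫_0^x f + (1/(e-1))∫_0^1 f gives Y_{1,1}=0). *)

theory Defs
  imports "HOL-Analysis.Analysis"
begin

(* Everything below is used on an open interval S, where deriv depends only on the
   restriction of a function to S. *)

definition times_differentiable_on :: "nat \<Rightarrow> (real \<Rightarrow> real) \<Rightarrow> real set \<Rightarrow> bool" where
  "times_differentiable_on n f S \<longleftrightarrow> (\<forall>q<n. (deriv ^^ q) f differentiable_on S)"

definition times_cont_differentiable_on :: "nat \<Rightarrow> (real \<Rightarrow> real) \<Rightarrow> real set \<Rightarrow> bool" where
  "times_cont_differentiable_on n f S \<longleftrightarrow>
     times_differentiable_on n f S \<and> continuous_on S ((deriv ^^ n) f)"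

definition is_solution :: "nat \<Rightarrow> (nat \<Rightarrow> real \<Rightarrow> real) \<Rightarrow> real set \<Rightarrow> (real \<Rightarrow> real) \<Rightarrow> bool" where
  "is_solution m a S Y \<longleftrightarrow>
     times_differentiable_on m Y S \<and>
     (\<forall>x\<in>S. (deriv ^^ m) Y x = (\<Sum>p=1..m. a p x * (deriv ^^ (m - p)) Y x))"

(* [f]_q. The fixed choice of antiderivative is the oriented integral from one base point c.
   An arbitrary operator J with (J f)' = f would not do, not even a linear one. With
   m = 1, a 1 = -1 and J f x = (integral of f over [0,x]) + (integral of f over [0,1]) / (e - 1),
   the series defining alpha sums to 1, so the claimed general solution would be 0. *)
primrec iter_int :: "real \<Rightarrow> nat \<Rightarrow> (real \<Rightarrow> real) \<Rightarrow> real \<Rightarrow> real" where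
  "iter_int c 0 f = f"
| "iter_int c (Suc q) f = (\<lambda>x. LBINT t=c..x. iter_int c q f t)"

definition b_coeff :: "nat \<Rightarrow> (nat \<Rightarrow> real \<Rightarrow> real) \<Rightarrow> nat \<Rightarrow> real \<Rightarrow> real" where
  "b_coeff m a k x =
     (\<Sum>i=1..k. (-1) ^ i * real ((m - i) choose (m - k)) * (deriv ^^ (k - i)) (a i) x)"

(* B_l for the index tuples i = (i_0, ..., i_r) and k = (k_0, ..., k_(r-1)) *)
primrec B_seq :: "nat \<Rightarrow> (nat \<Rightarrow> real \<Rightarrow> real) \<Rightarrow> real \<Rightarrow> nat \<Rightarrow> nat \<Rightarrow> (nat \<Rightarrow> nat) \<Rightarrow> (nat \<Rightarrow> nat)
    \<Rightarrow> nat \<Rightarrow> real \<Rightarrow> real" where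
  "B_seq m a c j r i k 0 = b_coeff m a (j + (\<Sum>l\<le>r. i l))"
| "B_seq m a c j r i k (Suc l) =
     (\<lambda>x. iter_int c (i l + k l) (B_seq m a c j r i k l) x * b_coeff m a (k l) x)"

definition T_fun :: "nat \<Rightarrow> (nat \<Rightarrow> real \<Rightarrow> real) \<Rightarrow> real \<Rightarrow> nat \<Rightarrow> nat \<Rightarrow> nat \<Rightarrow> real \<Rightarrow> real" where
  "T_fun m a c r n j x =
     (\<Sum>i | i \<in> {..r} \<rightarrow>\<^sub>E UNIV \<and> (\<Sum>l\<le>r. i l) \<le> m - j.
        (-1) ^ (\<Sum>l<r. i l) * ((- real n) gchoose (i r)) *
        (\<Sum>k \<in> {..<r} \<rightarrow>\<^sub>E {1..m}.
           (\<Prod>l<r. real ((k l - 1 + i l) choose (k l - 1))) *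
           iter_int c (n + i r) (B_seq m a c j r i k r) x))"

(* xi m a c s n and alpha m a c n stand for xi_(m,s)(-n) and alpha_m(-n) *)
fun xi :: "nat \<Rightarrow> (nat \<Rightarrow> real \<Rightarrow> real) \<Rightarrow> real \<Rightarrow> nat \<Rightarrow> nat \<Rightarrow> real \<Rightarrow> real" where
  "xi m a c s n x =
     T_fun m a c s n 1 x -
     (\<Sum>z\<in>{1..s}. \<Sum>j=1..m. T_fun m a c (z - 1) n j x * xi m a c (s - z) j x)"

declare xi.simps [simp del]

definition alpha :: "nat \<Rightarrow> (nat \<Rightarrow> real \<Rightarrow> real) \<Rightarrow> real \<Rightarrow> nat \<Rightarrow> real \<Rightarrow> real" where
  "alpha m a c n x = (\<Sum>s. xi m a c s n x)"

definition Y_sol :: "nat \<Rightarrow> (nat \<Rightarrow> real \<Rightarrow> real) \<Rightarrow> real \<Rightarrow> nat \<Rightarrow> real \<Rightarrow> real" where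
  "Y_sol m a c i x =
     (-1) ^ i * (1 - alpha m a c 1 x) * x ^ (i - 1) / fact (i - 1) +
     (\<Sum>k=2..i. (-1) ^ (k + i) * alpha m a c k x * x ^ (i - k) / fact (i - k))"

end

theory Submission
  imports Defs
begin

text \<open>
Integration by parts turns the equation into one that contains no derivative of the unknown function.
With \<open>J\<close> the integral from \<open>c\<close>, a solution is the same thing as a continuous function \<open>Y\<close> for which
\<open>Y - volterra Y\<close> is a polynomial of degree less than \<open>m\<close>, where \<open>volterra f\<close> is the sum of the
\<open>(-1)\<^sup>k J\<^sup>k (b\<^sub>k f)\<close> (\<open>is_solution_iff_volterra\<close>). On a compact interval \<open>volterra\<close> is a
contraction for a suitable weighted sup norm, so the solutions are exactly the combinations of the
Neumann series started from the polynomials \<open>(-x)\<^sup>q\<^sup>-\<^sup>1 / (q-1)!\<close> (\<open>volterra_solutions\<close>). What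
remains is to recognise \<open>Y_sol\<close> as these series, up to sign.

The link is the adjoint equation \<open>Z\<^sup>(\<^sup>m\<^sup>) = b\<^sub>1 Z\<^sup>(\<^sup>m\<^sup>-\<^sup>1\<^sup>) + ... + b\<^sub>m Z\<close>. Its Picard operator is
\<open>P g = J\<^sup>m (\<Sum>k. b\<^sub>k g\<^sup>(\<^sup>m\<^sup>-\<^sup>k\<^sup>))\<close>, and the Leibniz rule for iterated integrals (with
coefficients \<open>C(-n,i)\<close>) shows that \<open>T\<^sub>r(n;j)\<close> is the coefficient of \<open>g\<^sup>(\<^sup>m\<^sup>-\<^sup>j\<^sup>)\<close> in the
\<open>(m-n)\<close>-th derivative of \<open>P\<^sup>r\<^sup>+\<^sup>1 g\<close> for polynomials \<open>g\<close> of degree less than \<open>m\<close>. Replace \<open>b\<close> by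
\<open>t b\<close> and write \<open>T(t)\<close> for the matrix with entries \<open>\<Sum>r. T\<^sub>r(n;j) t\<^sup>r\<close>. Then
\<open>U(t) = I + t T(t)\<close> is the Wronskian matrix \<open>W(t)\<close> of the adjoint equation times the inverse of
the Wronskian matrix \<open>G\<close> of the monomials. The recursion that defines \<open>\<xi>\<close> says precisely that the
vector \<open>V(t) = e\<^sub>1 - t \<xi>(t)\<close> solves \<open>U(t) V(t) = e\<^sub>1\<close>. Hence \<open>G\<^sup>-\<^sup>1 V(t)\<close> is the first column of the
inverse of \<open>W(t)\<close>, and by the classical duality between an equation and its adjoint the entries
of that column solve the original equation with \<open>t a\<close> in place of \<open>a\<close>.

This is first an identity of formal power series in \<open>t\<close>. The rows of the formal inverse of the
Wronskian matrix are written down explicitly as iterated integrals (\<open>eta\<close>), and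
\<open>dual_pairing_coeff\<close> verifies the inverse by differentiation; \<open>y_eq_recursion\<close> concludes that
the coefficients of \<open>V\<close> and the terms of the Neumann series determine each other. The geometric
decay of the latter then gives the summability of \<open>\<xi>\<close> and permits \<open>t = 1\<close>.
\<close>

section \<open>Iterated integration on an interval\<close>

declare iter_int.simps(2) [simp del]

locale base_interval =
  fixes S :: "real set" and c :: real
  assumes open_S: "open S" and interval_S: "is_interval S" and c_in_S: "c \<in> S"
begin

abbreviation J where "J \<equiv> iter_int c"

lemma compact_neighbourhood:
  assumes "x \<in> S"
  obtains a b where "a < x" "x < b" "a < c" "c < b" "{a..b} \<subseteq> S"
proof -
  have lo: "min x c \<in> S" and hi: "max x c \<in> S"
    using assms c_in_S by (auto simp: min_def max_def)
  from openE[OF open_S lo] obtain d where d: "d > 0" "ball (min x c) d \<subseteq> S" .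
  from openE[OF open_S hi] obtain e where e: "e > 0" "ball (max x c) e \<subseteq> S" .
  let ?a = "min x c - d / 2" and ?b = "max x c + e / 2"
  have "dist (min x c) ?a < d" "dist (max x c) ?b < e"
    using d(1) e(1) by (simp_all add: dist_real_def)
  then have ab: "?a \<in> S" "?b \<in> S"
    by (metis d(2) mem_ball subsetD, metis e(2) mem_ball subsetD)
  then have "{?a..?b} \<subseteq> S"
    using interval_S unfolding is_interval_1 by (meson atLeastAtMost_iff subsetI)
  moreover have "?a < x" "x < ?b" "?a < c" "c < ?b"
    using d(1) e(1) by linarith+
  ultimately show ?thesis using that by blast
qed

lemma integral_has_derivative:
  assumes "continuous_on S f" "x \<in> S"
  shows "((\<lambda>x. LBINT t=c..x. f t) has_real_derivative f x) (at x)"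
proof -
  obtain a b where ab: "a < x" "x < b" "a < c" "c < b" "{a..b} \<subseteq> S"
    using compact_neighbourhood[OF assms(2)] .
  have "((\<lambda>x. LBINT t=c..x. f t) has_vector_derivative f x) (at x within {a..b})"
    using ab by (intro interval_integral_FTC2 continuous_on_subset[OF assms(1)]) auto
  moreover have "at x within {a..b} = at x"
    using ab by (intro at_within_interior) auto
  ultimately show ?thesis
    by (simp add: has_real_derivative_iff_has_vector_derivative)
qed

lemma iter_int_continuous:
  assumes "continuous_on S f"
  shows "continuous_on S (J q f)"
proof (induction q)
  case (Suc q)
  show ?case
    unfolding iter_int.simps
    using integral_has_derivative[OF Suc]
    by (meson DERIV_isCont continuous_at_imp_continuous_on)
qed (use assms in simp)

lemma iter_int_deriv:
  assumes "continuous_on S f" "x \<in> S"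
  shows "(J (Suc q) f has_real_derivative J q f x) (at x)"
  unfolding iter_int.simps
  by (rule integral_has_derivative[OF iter_int_continuous[OF assms(1)] assms(2)])

lemma iter_int_base [simp]: "q > 0 \<Longrightarrow> J q f c = 0"
  by (cases q) (auto simp: iter_int.simps)

lemma iter_int_add: "J p (J q f) = J (p + q) f"
  by (induction p) (auto simp: iter_int.simps)

lemma eq_on_if_same_deriv:
  assumes "\<And>x. x \<in> S \<Longrightarrow> (f has_real_derivative d x) (at x)"
    and "\<And>x. x \<in> S \<Longrightarrow> (g has_real_derivative d x) (at x)"
    and "f c = g c" "x \<in> S"
  shows "f x = g x"
proof -
  have "((\<lambda>x. f x - g x) has_real_derivative 0) (at x within S)" if "x \<in> S" for x
    using DERIV_diff[OF assms(1)[OF that] assms(2)[OF that]]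
    by (auto intro: has_field_derivative_at_within)
  moreover have "convex S" using interval_S is_interval_convex by blast
  ultimately obtain k where "\<forall>x\<in>S. f x - g x = k"
    using has_field_derivative_zero_constant[of S "\<lambda>x. f x - g x"] by blast
  then have "f x - g x = f c - g c"
    using assms(4) c_in_S by simp
  then show ?thesis
    using assms(3) by simp
qed

lemma iter_int_cong:
  assumes "continuous_on S f" "\<And>x. x \<in> S \<Longrightarrow> f x = g x" "x \<in> S"
  shows "J q f x = J q g x"
  using assms(3)
proof (induction q arbitrary: x)
  case (Suc q)
  have g: "continuous_on S g" using assms continuous_on_cong by metis
  show ?case
  proof (rule eq_on_if_same_deriv[OF _ _ _ Suc.prems])
    show "(J (Suc q) f has_real_derivative J q f x) (at x)" if "x \<in> S" for x
      using iter_int_deriv[OF assms(1) that] .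
    show "(J (Suc q) g has_real_derivative J q f x) (at x)" if "x \<in> S" for x
      using iter_int_deriv[OF g that] Suc.IH[OF that] by simp
  qed simp
qed (use assms in simp)

lemma iter_int_sum:
  assumes "\<And>i. i \<in> A \<Longrightarrow> continuous_on S (f i)" "x \<in> S"
  shows "J q (\<lambda>t. \<Sum>i\<in>A. w i * f i t) x = (\<Sum>i\<in>A. w i * J q (f i) x)"
  using assms(2)
proof (induction q arbitrary: x)
  case (Suc q)
  have cont: "continuous_on S (\<lambda>t. \<Sum>i\<in>A. w i * f i t)"
    using assms(1) by (intro continuous_intros) auto
  show ?case
  proof (rule eq_on_if_same_deriv[OF _ _ _ Suc.prems])
    fix x assume x: "x \<in> S"
    show "(J (Suc q) (\<lambda>t. \<Sum>i\<in>A. w i * f i t) has_real_derivative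
        (\<Sum>i\<in>A. w i * J q (f i) x)) (at x)"
      using iter_int_deriv[OF cont x, of q] Suc.IH[OF x] by simp
    show "((\<lambda>x. \<Sum>i\<in>A. w i * J (Suc q) (f i) x) has_real_derivative
        (\<Sum>i\<in>A. w i * J q (f i) x)) (at x)"
      using assms(1) x by (intro DERIV_sum DERIV_cmult iter_int_deriv) auto
  qed simp
qed simp

lemma iter_int_lincomb:
  assumes "continuous_on S f" "continuous_on S g" "x \<in> S"
  shows "J q (\<lambda>t. u * f t + v * g t) x = u * J q f x + v * J q g x"
proof -
  define h where "h = (\<lambda>i::bool. if i then f else g)"
  define w where "w = (\<lambda>i::bool. if i then u else v)"
  have "J q (\<lambda>t. \<Sum>i\<in>UNIV. w i * h i t) x = (\<Sum>i\<in>UNIV. w i * J q (h i) x)"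
    using assms by (intro iter_int_sum) (auto simp: h_def)
  then show ?thesis by (simp add: UNIV_bool h_def w_def add.commute)
qed

text \<open>
In the norm weighted by \<open>exp (L * \<bar>t - c\<bar>)\<close> each integration gains a factor \<open>1 / L\<close>. This is what makes
Volterra operators contractions without any restriction on the length of the interval.
\<close>

lemma iter_int_exp_bound:
  assumes f: "continuous_on S f" and ab: "a \<le> c" "c \<le> b" "{a..b} \<subseteq> S" and lam: "L > 0"
    and bd: "\<And>t. t \<in> {a..b} \<Longrightarrow> \<bar>f t\<bar> \<le> A * exp (L * \<bar>t - c\<bar>)"
    and x: "x \<in> {a..b}"
  shows "\<bar>J q f x\<bar> \<le> A / L ^ q * exp (L * \<bar>x - c\<bar>)"
  using x
proof (induction q arbitrary: x)
  case (Suc q)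
  let ?A = "A / L ^ q"
  have "\<bar>f c\<bar> \<le> A" using bd[of c] ab by simp
  then have A: "?A / L \<ge> 0" using lam by simp
  have D: "(J (Suc q) f has_real_derivative J q f t) (at t)" if "t \<in> {a..b}" for t
    using iter_int_deriv[OF f] ab that by blast
  have E: "((\<lambda>t. ?A / L * exp (L * (s * (t - c)))) has_real_derivative
      ?A * exp (L * (s * (t - c))) * s) (at t)" for s t :: real
    using lam by (auto intro!: derivative_eq_intros)
  have "\<bar>J (Suc q) f x\<bar> \<le> ?A / L * exp (L * \<bar>x - c\<bar>)"
  proof (cases "x \<ge> c")
    case True
    have R: "\<bar>J q f t\<bar> \<le> ?A * exp (L * (t - c))" if "c \<le> t" "t \<le> x" for t
      using Suc.IH[of t] that ab Suc.prems by auto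
    \<comment> \<open>With \<open>s = 1\<close> and \<open>s = -1\<close> this monotonicity gives the two halves of the absolute value bound.\<close>
    have "(\<lambda>t. ?A / L * exp (L * (1 * (t - c))) + s * J (Suc q) f t) c \<le>
        (\<lambda>t. ?A / L * exp (L * (1 * (t - c))) + s * J (Suc q) f t) x" if s: "\<bar>s\<bar> = 1" for s
    proof (rule DERIV_nonneg_imp_nondecreasing[OF True])
      fix t assume t: "c \<le> t" "t \<le> x"
      show "\<exists>y. ((\<lambda>t. ?A / L * exp (L * (1 * (t - c))) + s * J (Suc q) f t) has_real_derivative y) (at t) \<and> 0 \<le> y"
        using DERIV_add[OF E[of 1 t] DERIV_cmult[OF D[of t], of s]] R[OF t] s t ab Suc.prems
        by (intro exI conjI) (auto simp: abs_if split: if_splits)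
    qed
    from this[of 1] this[of "-1"] A show ?thesis using True by auto
  next
    case False
    have R: "\<bar>J q f t\<bar> \<le> ?A * exp (L * (-1 * (t - c)))" if "x \<le> t" "t \<le> c" for t
      using Suc.IH[of t] that ab Suc.prems by auto
    have "(\<lambda>t. ?A / L * exp (L * (-1 * (t - c))) + s * J (Suc q) f t) c \<le>
        (\<lambda>t. ?A / L * exp (L * (-1 * (t - c))) + s * J (Suc q) f t) x" if s: "\<bar>s\<bar> = 1" for s
    proof (rule DERIV_nonpos_imp_nonincreasing[of x c])
      fix t assume t: "x \<le> t" "t \<le> c"
      show "\<exists>y. ((\<lambda>t. ?A / L * exp (L * (-1 * (t - c))) + s * J (Suc q) f t) has_real_derivative y) (at t) \<and> y \<le> 0"
        using DERIV_add[OF E[of "-1" t] DERIV_cmult[OF D[of t], of s]] R[OF t] s t ab Suc.prems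
        by (intro exI conjI) (auto simp: abs_if split: if_splits)
    qed (use False in simp)
    from this[of 1] this[of "-1"] A show ?thesis using False by auto
  qed
  then show ?case by (simp add: field_simps)
qed (use bd in simp)

end

section \<open>The adjoint system and its formal solutions\<close>

text \<open>
The Wronskian matrix of the monomials \<open>x\<^sup>m\<^sup>-\<^sup>q / (m-q)!\<close>, \<open>q = 1, \<dots>, m\<close>, with the row \<open>n\<close> holding
derivatives of order \<open>m - n\<close>. It is the exponential of \<open>x\<close> times a nilpotent shift, so arguments add
under multiplication and its inverse is obtained by changing the sign of \<open>x\<close>.
\<close>

definition taylor :: "real \<Rightarrow> nat \<Rightarrow> nat \<Rightarrow> real" where
  "taylor x n q = (if q \<le> n then x ^ (n - q) / fact (n - q) else 0)"

lemma taylor_0: "taylor 0 n q = of_bool (n = q)"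
  by (auto simp: taylor_def)

lemma taylor_add:
  assumes "n \<in> {1..m}" "q \<in> {1..m}"
  shows "(\<Sum>l=1..m. taylor x n l * taylor y l q) = taylor (x + y) n q"
proof (cases "q \<le> n")
  case True
  have "(\<Sum>l=1..m. taylor x n l * taylor y l q) = (\<Sum>l=q..n. taylor x n l * taylor y l q)"
    using assms by (intro sum.mono_neutral_right) (auto simp: taylor_def)
  also have "\<dots> = (\<Sum>s\<le>n - q. taylor x n (q + s) * taylor y (q + s) q)"
    using True by (intro sum.reindex_bij_witness[of _ "\<lambda>s. q + s" "\<lambda>l. l - q"]) auto
  also have "\<dots> = (\<Sum>s\<le>n - q. real ((n - q) choose s) * y ^ s * x ^ (n - q - s) / fact (n - q))"
    using True by (intro sum.cong) (auto simp: taylor_def binomial_fact field_simps)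
  also have "\<dots> = (y + x) ^ (n - q) / fact (n - q)"
    by (simp add: binomial_ring sum_divide_distrib)
  finally show ?thesis using True by (simp add: taylor_def add.commute)
next
  case False
  then have "taylor x n l * taylor y l q = 0" for l by (auto simp: taylor_def)
  then have "(\<Sum>l=1..m. taylor x n l * taylor y l q) = 0" by (intro sum.neutral) auto
  then show ?thesis using False by (simp only: taylor_def if_False)
qed

lemma power_over_fact_deriv:
  fixes x :: real
  shows "((\<lambda>x. x ^ Suc d / fact (Suc d)) has_real_derivative x ^ d / fact d) (at x)"
  using DERIV_cdivide[OF DERIV_pow[of "Suc d" x UNIV], of "fact (Suc d)"]
  by (simp add: fact_Suc del: of_nat_Suc power_Suc)

lemma taylor_deriv:
  assumes "q \<ge> 1"
  shows "((\<lambda>x. taylor x n q) has_real_derivative taylor x (n - 1) q) (at x)"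
proof (cases "n - q")
  case 0
  then show ?thesis using assms by (cases "n = q") (auto simp: taylor_def)
next
  case (Suc d)
  then have "n - 1 - q = d" "q \<le> n - 1" by auto
  moreover have "q \<le> n" using Suc by auto
  ultimately show ?thesis using Suc power_over_fact_deriv[of d x]
    by (simp add: taylor_def del: power_Suc fact_Suc)
qed

lemma taylor_deriv_uminus:
  "((\<lambda>x. taylor (- x) q n) has_real_derivative - taylor (- x) q (Suc n)) (at x)"
proof (cases "q - n")
  case 0
  then show ?thesis by (cases "n = q") (auto simp: taylor_def)
next
  case (Suc d)
  then have "q - Suc n = d" "Suc n \<le> q" by auto
  moreover have "((\<lambda>x. (- x) ^ Suc d / fact (Suc d)) has_real_derivative - ((- x) ^ d / fact d)) (at x)"
    using DERIV_chain2[OF power_over_fact_deriv DERIV_minus[OF DERIV_ident], of d x] by simp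
  ultimately show ?thesis using Suc by (simp add: taylor_def)
qed

text \<open>
The coefficients \<open>b\<close> of the adjoint equation need only be continuous for everything that concerns
its formal solutions and the Volterra equation dual to it.
\<close>

locale adjoint_system = base_interval +
  fixes m :: nat and b :: "nat \<Rightarrow> real \<Rightarrow> real"
  assumes b_continuous: "k \<in> {1..m} \<Longrightarrow> continuous_on S (b k)"
begin

text \<open>
For a polynomial \<open>g\<close> of degree less than \<open>m\<close> and the Picard operator
\<open>P g = J m (\<Sum>k. b k * g\<^sup>(\<^sup>m\<^sup>-\<^sup>k\<^sup>))\<close>, the function \<open>kernel r p\<close> is the coefficient of \<open>g\<^sup>(\<^sup>m\<^sup>-\<^sup>p\<^sup>)\<close> in the
\<open>m\<close>-th derivative of \<open>P\<^sup>r\<^sup>+\<^sup>1 g\<close>. Integrating \<open>n\<close> times by the Leibniz rule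
\<open>J n (f * h) = \<Sum>i. C(-n, i) * J (n + i) f * h\<^sup>(\<^sup>i\<^sup>)\<close> for polynomials \<open>h\<close> leads to \<open>T\<close>.
\<close>

primrec kernel :: "nat \<Rightarrow> nat \<Rightarrow> real \<Rightarrow> real" where
  "kernel 0 p = b p"
| "kernel (Suc r) p = (\<lambda>x. \<Sum>k=1..m. b k x *
     (\<Sum>i\<le>m - p. (- real k gchoose i) * J (k + i) (kernel r (p + i)) x))"

text \<open>
The index set is written so that the value is \<open>0\<close> for \<open>j = Suc m\<close>, where truncated subtraction would leave
the term \<open>i = 0\<close>; \<open>T_deriv\<close> refers to that value.
\<close>

definition T :: "nat \<Rightarrow> nat \<Rightarrow> nat \<Rightarrow> real \<Rightarrow> real" where
  "T r n j x = (\<Sum>i\<in>{i. j + i \<le> m}. (- real n gchoose i) * J (n + i) (kernel r (j + i)) x)"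

lemma T_altdef: "j \<le> m \<Longrightarrow> T r n j x = (\<Sum>i\<le>m - j. (- real n gchoose i) * J (n + i) (kernel r (j + i)) x)"
  unfolding T_def by (intro sum.cong) auto

lemma kernel_Suc: "p \<le> m \<Longrightarrow> kernel (Suc r) p x = (\<Sum>k=1..m. b k x * T r k p x)"
  by (simp add: T_altdef)

lemma kernel_continuous: "p \<in> {1..m} \<Longrightarrow> continuous_on S (kernel r p)"
proof (induction r arbitrary: p)
  case (Suc r)
  then show ?case
    by (auto intro!: continuous_intros b_continuous iter_int_continuous)
qed (use b_continuous in auto)

lemma T_0: assumes "j \<le> m" shows "T r 0 j x = kernel r j x"
proof -
  have "T r 0 j x = (\<Sum>i\<le>m - j. if i = 0 then kernel r j x else 0)"
    unfolding T_altdef[OF assms] by (intro sum.cong) (auto simp: gbinomial_0_left)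
  then show ?thesis by simp
qed

lemma T_eq_0: "m < j \<Longrightarrow> T r n j x = 0"
  by (simp add: T_def)

lemma T_base: "n \<ge> 1 \<Longrightarrow> T r n j c = 0"
  by (simp add: T_def)

text \<open>
The product rule for \<open>\<Sum>j. T r n j * g\<^sup>(\<^sup>m\<^sup>-\<^sup>j\<^sup>)\<close>, read off coefficient by coefficient. On the level of
the formula it is the Pascal rule for \<open>C(-n, i)\<close>.
\<close>

lemma T_deriv:
  assumes x: "x \<in> S" and j: "j \<in> {1..m}"
  shows "(T r (Suc n) j has_real_derivative T r n j x - T r (Suc n) (Suc j) x) (at x)"
proof -
  let ?D = "\<lambda>i. J (n + i) (kernel r (j + i)) x"
  have *: "((\<lambda>x. T r (Suc n) j x) has_real_derivative
      (\<Sum>i\<in>{i. j + i \<le> m}. (- real (Suc n) gchoose i) * ?D i)) (at x)"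
    unfolding T_def using j
    by (auto intro!: DERIV_sum DERIV_cmult iter_int_deriv[OF kernel_continuous x])
  have P: "(- real (Suc n) gchoose Suc i) = (- real n gchoose Suc i) - (- real (Suc n) gchoose i)" for i
    using gbinomial_Suc_Suc[of "- real (Suc n)" i] by simp
  have "(\<Sum>i\<in>{i. j + i \<le> m}. (- real (Suc n) gchoose i) * ?D i)
      = (\<Sum>i\<in>{i. j + i \<le> m}. (- real n gchoose i) * ?D i
          - (if i = 0 then 0 else (- real (Suc n) gchoose (i - 1)) * ?D i))"
  proof (rule sum.cong[OF refl])
    fix i
    show "(- real (Suc n) gchoose i) * ?D i = (- real n gchoose i) * ?D i
          - (if i = 0 then 0 else (- real (Suc n) gchoose (i - 1)) * ?D i)"
      by (cases i) (simp_all add: P left_diff_distrib del: of_nat_Suc)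
  qed
  also have "\<dots> = T r n j x - (\<Sum>i\<in>{i. j + i \<le> m}. if i = 0 then 0 else (- real (Suc n) gchoose (i - 1)) * ?D i)"
    by (simp add: sum_subtractf T_def)
  also have "(\<Sum>i\<in>{i. j + i \<le> m}. if i = 0 then 0 else (- real (Suc n) gchoose (i - 1)) * ?D i)
      = (\<Sum>i\<in>{i. j + i \<le> m} - {0}. (- real (Suc n) gchoose (i - 1)) * ?D i)"
    by (intro sum.mono_neutral_cong_right) (auto intro: finite_subset[of _ "{..m}"])
  also have "\<dots> = T r (Suc n) (Suc j) x"
    unfolding T_def by (intro sum.reindex_bij_witness[of _ Suc "\<lambda>i. i - 1"]) auto
  finally show ?thesis using * by simp
qed

text \<open>
\<open>Phi q r n\<close> is the derivative of order \<open>m - n\<close> of the \<open>r\<close>-th Picard iterate of the adjoint equation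
started from the monomial \<open>x\<^sup>m\<^sup>-\<^sup>q / (m-q)!\<close>. The row \<open>n = 0\<close> is the derivative of order \<open>m\<close>, which the
equation expresses through the preceding iterate (\<open>Phi_0_Suc\<close>).
\<close>

fun Phi :: "nat \<Rightarrow> nat \<Rightarrow> nat \<Rightarrow> real \<Rightarrow> real" where
  "Phi q 0 n x = taylor x n q"
| "Phi q (Suc r) n x = (\<Sum>j=1..m. T r n j x * taylor x j q)"

lemma Phi_deriv:
  assumes x: "x \<in> S" and q: "q \<in> {1..m}"
  shows "(Phi q r (Suc n) has_real_derivative Phi q r n x) (at x)"
proof (cases r)
  case 0
  have "Phi q r (Suc n) = (\<lambda>x. taylor x (Suc n) q)" using 0 by (auto simp: fun_eq_iff)
  then show ?thesis using taylor_deriv[of q "Suc n" x] q 0 by auto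
next
  case (Suc r')
  let ?t = "\<lambda>j. taylor x j q"
  have "((\<lambda>x. Phi q r (Suc n) x) has_real_derivative
      (\<Sum>j=1..m. (T r' n j x - T r' (Suc n) (Suc j) x) * ?t j + T r' (Suc n) j x * ?t (j - 1))) (at x)"
    unfolding Suc Phi.simps using x q
    by (intro DERIV_sum) (auto intro!: derivative_eq_intros T_deriv taylor_deriv)
  also have "(\<Sum>j=1..m. (T r' n j x - T r' (Suc n) (Suc j) x) * ?t j + T r' (Suc n) j x * ?t (j - 1))
     = Phi q r n x + (\<Sum>j=1..m. T r' (Suc n) j x * ?t (j - 1) - T r' (Suc n) (Suc j) x * ?t j)"
    by (simp add: Suc sum.distrib sum_subtractf algebra_simps)
  also have "(\<Sum>j=1..m. T r' (Suc n) j x * ?t (j - 1) - T r' (Suc n) (Suc j) x * ?t j)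
     = T r' (Suc n) 1 x * ?t 0 - T r' (Suc n) (Suc m) x * ?t m"
    using sum_telescope''[of 0 m "\<lambda>j. - (T r' (Suc n) (Suc j) x * ?t j)"]
    by (simp add: atLeastSucAtMost_greaterThanAtMost sum_subtractf algebra_simps)
  also have "\<dots> = 0" using q by (simp add: T_eq_0 taylor_def)
  finally show ?thesis by simp
qed

lemma Phi_0_Suc:
  assumes q: "q \<in> {1..m}"
  shows "Phi q (Suc r) 0 x = (\<Sum>k=1..m. b k x * Phi q r k x)"
proof (cases r)
  case 0
  then show ?thesis by (simp add: T_0)
next
  case (Suc r')
  have "Phi q (Suc r) 0 x = (\<Sum>j=1..m. (\<Sum>k=1..m. b k x * T r' k j x) * taylor x j q)"
    unfolding Phi.simps using Suc by (intro sum.cong) (auto simp: T_0 kernel_Suc simp del: kernel.simps)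
  also have "\<dots> = (\<Sum>k=1..m. b k x * Phi q r k x)"
    unfolding Suc Phi.simps sum_distrib_left sum_distrib_right
    by (subst sum.swap) (simp add: mult.assoc)
  finally show ?thesis .
qed

lemma Phi_base: "n \<ge> 1 \<Longrightarrow> Phi q (Suc r) n c = 0"
  by (simp add: T_base)

text \<open>
The adjoint of the Picard operator. For \<open>b = b_coeff m a\<close> it is, modulo polynomials of degree less than
\<open>m\<close>, the \<open>m\<close>-fold integral of the right-hand side of the given differential equation.
\<close>

definition volterra :: "(real \<Rightarrow> real) \<Rightarrow> real \<Rightarrow> real" where
  "volterra f x = (\<Sum>k=1..m. (-1) ^ k * J k (\<lambda>t. b k t * f t) x)"

primrec y :: "nat \<Rightarrow> nat \<Rightarrow> real \<Rightarrow> real" where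
  "y q 0 = (\<lambda>x. taylor (- x) q 1)"
| "y q (Suc s) = volterra (y q s)"

text \<open>
The coefficient of \<open>t\<^sup>s\<close> in the row \<open>q\<close> of the inverse of the adjoint Wronskian matrix. A row of an
inverse fundamental matrix solves \<open>\<eta>\<^sub>n' = - \<eta>\<^sub>n\<^sub>+\<^sub>1 - t b\<^sub>n \<eta>\<^sub>1\<close> with \<open>\<eta>\<^sub>m\<^sub>+\<^sub>1 = 0\<close>; solving
downwards from \<open>n = m\<close> expresses each order through the first component \<open>y\<close> of the preceding order.
\<close>

fun eta :: "nat \<Rightarrow> nat \<Rightarrow> nat \<Rightarrow> real \<Rightarrow> real" where
  "eta q 0 n x = taylor (- x) q n"
| "eta q (Suc s) n x = (\<Sum>k\<in>{n..m}. (-1) ^ (k - n + 1) * J (k - n + 1) (\<lambda>t. b k t * y q s t) x)"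

text \<open>
The coefficients of \<open>t b\<^sub>n \<eta>\<^sub>1\<close>: the factor \<open>t\<close> shifts the order by one.
\<close>

fun forcing :: "nat \<Rightarrow> nat \<Rightarrow> nat \<Rightarrow> real \<Rightarrow> real" where
  "forcing q 0 n x = 0"
| "forcing q (Suc s) n x = b n x * y q s x"

lemma volterra_continuous: "continuous_on S f \<Longrightarrow> continuous_on S (volterra f)"
  unfolding volterra_def by (auto intro!: continuous_intros iter_int_continuous b_continuous)

lemma y_continuous: "continuous_on S (y q s)"
proof (induction s)
  case 0
  show ?case
    unfolding y.simps using taylor_deriv_uminus
    by (meson DERIV_isCont continuous_at_imp_continuous_on)
qed (simp add: volterra_continuous)

lemma eta_1: "eta q s 1 x = y q s x"
  by (cases s) (auto simp: volterra_def intro!: sum.cong)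

lemma eta_deriv:
  assumes x: "x \<in> S" and n: "n \<in> {1..m}"
  shows "(eta q s n has_real_derivative - eta q s (Suc n) x - forcing q s n x) (at x)"
proof (cases s)
  case 0
  have "eta q s n = (\<lambda>x. taylor (- x) q n)" using 0 by (auto simp: fun_eq_iff)
  then show ?thesis using taylor_deriv_uminus[of q n x] 0 by auto
next
  case (Suc s')
  let ?f = "\<lambda>k t. b k t * y q s' t"
  have cont: "continuous_on S (?f k)" if "k \<in> {1..m}" for k
    using that by (intro continuous_intros b_continuous y_continuous)
  have "((\<lambda>x. eta q s n x) has_real_derivative
      (\<Sum>k\<in>{n..m}. (-1) ^ (k - n + 1) * J (k - n) (?f k) x)) (at x)"
    unfolding Suc eta.simps add.right_neutral add_Suc_right One_nat_def
    using n by (intro DERIV_sum DERIV_cmult iter_int_deriv cont x) auto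
  also have "(\<Sum>k\<in>{n..m}. (-1) ^ (k - n + 1) * J (k - n) (?f k) x)
      = - ?f n x + (\<Sum>k\<in>{Suc n..m}. (-1) ^ (k - n + 1) * J (k - n) (?f k) x)"
    using n by (subst sum.atLeast_Suc_atMost) auto
  also have "(\<Sum>k\<in>{Suc n..m}. (-1) ^ (k - n + 1) * J (k - n) (?f k) x)
      = - eta q s (Suc n) x"
    unfolding Suc eta.simps sum_negf[symmetric]
  proof (rule sum.cong[OF refl])
    fix k assume "k \<in> {Suc n..m}"
    then have "k - n = Suc (k - Suc n)" by auto
    then show "(-1) ^ (k - n + 1) * J (k - n) (?f k) x
      = - ((-1) ^ (k - Suc n + 1) * J (k - Suc n + 1) (?f k) x)" by simp
  qed
  moreover have "forcing q s n x = ?f n x" by (simp add: Suc)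
  ultimately show ?thesis by (simp del: eta.simps)
qed

lemma eta_top: "eta q s (Suc m) x * Phi q' r m x = 0" if "q \<le> m"
  using that by (cases s) (auto simp: taylor_def)

lemma eta_base: "eta q (Suc s) n c = 0"
  by simp

text \<open>
The product of the candidate inverse with the Wronskian matrix is the identity, as formal power
series in \<open>t\<close>. It is constant because the two systems are dual: the shift terms of the derivative
telescope over \<open>n\<close>, and the terms with \<open>b\<close> cancel after a shift of the order. At \<open>c\<close> all
coefficients of positive order vanish, and order \<open>0\<close> is \<open>taylor_add\<close>.
\<close>

lemma dual_pairing_coeff:
  assumes q: "q \<in> {1..m}" and q': "q' \<in> {1..m}" and x: "x \<in> S"
  shows "(\<Sum>r\<le>N. \<Sum>n=1..m. eta q (N - r) n x * Phi q' r n x) = of_bool (N = 0 \<and> q = q')"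
proof (cases N)
  case 0
  then show ?thesis using taylor_add[OF q q', of "- x" x] by (simp add: taylor_0)
next
  case (Suc M)
  let ?P = "\<lambda>x. \<Sum>r\<le>N. \<Sum>n=1..m. eta q (N - r) n x * Phi q' r n x"
  \<comment> \<open>The derivative is computed in two steps: telescoping over \<open>n\<close>, then matching \<open>r\<close> with \<open>Suc r\<close>.\<close>
  have D: "(?P has_real_derivative 0) (at x)" if x: "x \<in> S" for x
  proof -
    have "(?P has_real_derivative (\<Sum>r\<le>N. \<Sum>n=1..m.
        eta q (N - r) n x * Phi q' r (n - 1) x
        + (- eta q (N - r) (Suc n) x - forcing q (N - r) n x) * Phi q' r n x)) (at x)"
    proof (intro DERIV_sum)
      fix r n assume n: "n \<in> {1..m}"
      then have "(Phi q' r n has_real_derivative Phi q' r (n - 1) x) (at x)"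
        using Phi_deriv[OF x q', of r "n - 1"] by simp
      from DERIV_mult[OF eta_deriv[OF x n, of q "N - r"] this]
      show "((\<lambda>x. eta q (N - r) n x * Phi q' r n x) has_real_derivative
        eta q (N - r) n x * Phi q' r (n - 1) x
        + (- eta q (N - r) (Suc n) x - forcing q (N - r) n x) * Phi q' r n x) (at x)"
        by (simp add: algebra_simps)
    qed
    also have "(\<Sum>r\<le>N. \<Sum>n=1..m. eta q (N - r) n x * Phi q' r (n - 1) x
        + (- eta q (N - r) (Suc n) x - forcing q (N - r) n x) * Phi q' r n x)
      = (\<Sum>r\<le>N. eta q (N - r) 1 x * Phi q' r 0 x - (\<Sum>n=1..m. forcing q (N - r) n x * Phi q' r n x))"
    proof (rule sum.cong[OF refl])
      fix r
      let ?u = "\<lambda>n. - (eta q (N - r) (Suc n) x * Phi q' r n x)"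
      have "(\<Sum>n=1..m. ?u n - ?u (n - 1)) = eta q (N - r) 1 x * Phi q' r 0 x"
        using sum_telescope''[of 0 m ?u] eta_top[of q "N - r" x q' r] q
        by (simp add: atLeastSucAtMost_greaterThanAtMost)
      moreover have "(\<Sum>n=1..m. eta q (N - r) n x * Phi q' r (n - 1) x
        + (- eta q (N - r) (Suc n) x - forcing q (N - r) n x) * Phi q' r n x)
        = (\<Sum>n=1..m. (?u n - ?u (n - 1)) - forcing q (N - r) n x * Phi q' r n x)"
        by (intro sum.cong) (auto simp: algebra_simps)
      ultimately show "(\<Sum>n=1..m. eta q (N - r) n x * Phi q' r (n - 1) x
        + (- eta q (N - r) (Suc n) x - forcing q (N - r) n x) * Phi q' r n x)
        = eta q (N - r) 1 x * Phi q' r 0 x - (\<Sum>n=1..m. forcing q (N - r) n x * Phi q' r n x)"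
        by (simp only: sum_subtractf)
    qed
    also have "\<dots> = (\<Sum>r\<le>N. eta q (N - r) 1 x * Phi q' r 0 x)
        - (\<Sum>r\<le>N. \<Sum>n=1..m. forcing q (N - r) n x * Phi q' r n x)"
      by (rule sum_subtractf)
    also have "(\<Sum>r\<le>N. eta q (N - r) 1 x * Phi q' r 0 x)
        = (\<Sum>r\<le>M. y q (M - r) x * (\<Sum>k=1..m. b k x * Phi q' r k x))"
      unfolding Suc sum.atMost_Suc_shift Phi_0_Suc[OF q'] eta_1
      using q' by (simp add: taylor_def)
    also have "(\<Sum>r\<le>N. \<Sum>n=1..m. forcing q (N - r) n x * Phi q' r n x)
        = (\<Sum>r\<le>M. \<Sum>n=1..m. b n x * y q (M - r) x * Phi q' r n x)"
      unfolding Suc sum.atMost_Suc by (simp add: Suc_diff_le)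
    finally show ?thesis by (simp add: sum_distrib_left mult_ac)
  qed
  have "?P c = 0"
  proof (intro sum.neutral ballI)
    fix r n assume "n \<in> {1..m}"
    then show "eta q (N - r) n c * Phi q' r n c = 0"
      using Phi_base eta_base Suc by (cases r) (auto simp del: eta.simps Phi.simps)
  qed
  then have "?P x = 0"
    using eq_on_if_same_deriv[OF D, of "\<lambda>_. 0" x] x by simp
  then show ?thesis using Suc by simp
qed

text \<open>
At a fixed point \<open>x\<close>, let \<open>U\<close>, \<open>V\<close> and \<open>e\<close> be the power series in \<open>t\<close> formed from \<open>I + t T\<close>, from
\<open>e\<^sub>1 - t X\<close> and from \<open>eta\<close>. The recursion for \<open>X\<close> says \<open>U V = e\<^sub>1\<close>, while the dual pairing says
\<open>e U = taylor (- x)\<close>. Multiplying the first by \<open>e\<close> from the left gives the claim, so no formal inverse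
of \<open>U\<close> has to be constructed.
\<close>

lemma y_eq_recursion:
  assumes x: "x \<in> S" and q: "q \<in> {1..m}"
    and X: "\<And>n s. n \<in> {1..m} \<Longrightarrow>
       X s n = T s n 1 x - (\<Sum>z=1..s. \<Sum>j=1..m. T (z - 1) n j x * X (s - z) j)"
  shows "y q s x = (\<Sum>j=1..m. taylor (- x) q j * (case s of 0 \<Rightarrow> of_bool (j = 1) | Suc s' \<Rightarrow> - X s' j))"
proof -
  define U where "U = (\<lambda>n j. Abs_fps (\<lambda>r. case r of 0 \<Rightarrow> of_bool (n = j) | Suc r' \<Rightarrow> T r' n j x))"
  define V where "V = (\<lambda>j. Abs_fps (\<lambda>s. case s of 0 \<Rightarrow> of_bool (j = (1::nat)) | Suc s' \<Rightarrow> - X s' j))"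
  define e where "e = (\<lambda>q n. Abs_fps (\<lambda>s. eta q s n x))"
  define g where "g = (\<lambda>j q. fps_const (taylor x j q))"
  define h where "h = (\<lambda>j q. fps_const (taylor (- x) j q))"
  have UV: "(\<Sum>j=1..m. U n j * V j) = fps_const (of_bool (n = 1))" if n: "n \<in> {1..m}" for n
  proof (rule fps_ext)
    fix N
    show "fps_nth (\<Sum>j=1..m. U n j * V j) N = fps_nth (fps_const (of_bool (n = 1))) N"
    proof (cases N)
      case 0
      then show ?thesis using n by (auto simp: fps_sum_nth U_def V_def)
    next
      case (Suc s)
      have "fps_nth (U n j * V j) N = (if n = j then - X s j else 0)
          - (\<Sum>z=1..s. T (z - 1) n j x * X (s - z) j)
          + (if j = 1 then T s n j x else 0)" for j
      proof -
        have "fps_nth (U n j * V j) N = fps_nth (U n j) 0 * fps_nth (V j) (Suc s) + (\<Sum>i=0..s. fps_nth (U n j) (Suc i) * fps_nth (V j) (s - i))"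
          unfolding fps_mult_nth Suc sum.atLeast0_atMost_Suc_shift by simp
        also have "(\<Sum>i=0..s. fps_nth (U n j) (Suc i) * fps_nth (V j) (s - i))
            = (\<Sum>i<s. T i n j x * fps_nth (V j) (s - i)) + T s n j x * fps_nth (V j) 0"
          by (simp add: atLeast0AtMost lessThan_Suc_atMost[symmetric] U_def)
        also have "(\<Sum>i<s. T i n j x * fps_nth (V j) (s - i)) = (\<Sum>z=1..s. - (T (z - 1) n j x * X (s - z) j))"
        proof -
          have "fps_nth (V j) (s - i) = - X (s - Suc i) j" if "i < s" for i
            using less_imp_Suc_add[OF that] by (auto simp: V_def)
          then show ?thesis
            by (intro sum.reindex_bij_witness[of _ "\<lambda>z. z - 1" Suc]) auto
        qed
        finally show ?thesis by (simp add: U_def V_def sum_negf)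
      qed
      then have "fps_nth (\<Sum>j=1..m. U n j * V j) N = - X s n
          - (\<Sum>j=1..m. \<Sum>z=1..s. T (z - 1) n j x * X (s - z) j) + T s n 1 x"
        using n by (simp add: fps_sum_nth sum.distrib sum_subtractf)
      also have "\<dots> = 0"
        by (subst sum.swap) (simp add: X[OF n, of s])
      finally show ?thesis using Suc by simp
    qed
  qed
  have dual: "(\<Sum>n=1..m. e q n * (\<Sum>j=1..m. U n j * g j q')) = fps_const (of_bool (q = q'))"
    if q': "q' \<in> {1..m}" for q'
  proof (rule fps_ext)
    fix N
    have "fps_nth (\<Sum>j=1..m. U n j * g j q') r = Phi q' r n x" if n: "n \<in> {1..m}" for n r
    proof (cases r)
      case 0
      have "fps_nth (\<Sum>j=1..m. U n j * g j q') r = (\<Sum>j=1..m. if n = j then taylor x j q' else 0)"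
        unfolding fps_sum_nth using 0 by (intro sum.cong) (auto simp: U_def g_def)
      then show ?thesis using n 0 by simp
    qed (simp add: fps_sum_nth U_def g_def)
    note nth = this
    have "fps_nth (\<Sum>n=1..m. e q n * (\<Sum>j=1..m. U n j * g j q')) N
        = (\<Sum>n=1..m. \<Sum>r\<le>N. eta q (N - r) n x * Phi q' r n x)"
      unfolding fps_sum_nth
    proof (rule sum.cong[OF refl])
      fix n assume n: "n \<in> {1..m}"
      show "fps_nth (e q n * (\<Sum>j=1..m. U n j * g j q')) N = (\<Sum>r\<le>N. eta q (N - r) n x * Phi q' r n x)"
        unfolding mult.commute[of "e q n"] fps_mult_nth nth[OF n] atLeast0AtMost
        by (simp add: e_def mult.commute)
    qed
    also have "\<dots> = of_bool (N = 0 \<and> q = q')"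
      using dual_pairing_coeff[OF q q' x] by (subst sum.swap) simp
    finally show "fps_nth (\<Sum>n=1..m. e q n * (\<Sum>j=1..m. U n j * g j q')) N = fps_nth (fps_const (of_bool (q = q'))) N"
      by simp
  qed
  have gh: "(\<Sum>q'=1..m. g l q' * h q' j) = fps_const (of_bool (l = j))"
    if "l \<in> {1..m}" "j \<in> {1..m}" for l j
  proof (rule fps_ext)
    fix N
    have "fps_nth (\<Sum>q'=1..m. g l q' * h q' j) N
        = (if N = 0 then \<Sum>q'=1..m. taylor x l q' * taylor (- x) q' j else 0)"
      by (simp add: fps_sum_nth g_def h_def)
    then show "fps_nth (\<Sum>q'=1..m. g l q' * h q' j) N = fps_nth (fps_const (of_bool (l = j))) N"
      unfolding taylor_add[OF that] by (simp add: taylor_0)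
  qed
  have eU: "(\<Sum>n=1..m. e q n * U n j) = h q j" if j: "j \<in> {1..m}" for j
  proof -
    have "(\<Sum>n=1..m. e q n * U n j) = (\<Sum>n=1..m. e q n * (\<Sum>l=1..m. U n l * fps_const (of_bool (l = j))))"
    proof (rule sum.cong[OF refl])
      fix n
      have "(\<Sum>l=1..m. U n l * fps_const (of_bool (l = j))) = (\<Sum>l=1..m. if l = j then U n l else 0)"
        by (intro sum.cong) auto
      then show "e q n * U n j = e q n * (\<Sum>l=1..m. U n l * fps_const (of_bool (l = j)))"
        using j by simp
    qed
    also have "\<dots> = (\<Sum>n=1..m. e q n * (\<Sum>l=1..m. U n l * (\<Sum>q'=1..m. g l q' * h q' j)))"
      using gh j by (intro sum.cong arg_cong2[of _ _ _ _ "(*)"]) auto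
    also have "\<dots> = (\<Sum>n=1..m. \<Sum>q'=1..m. e q n * ((\<Sum>l=1..m. U n l * g l q') * h q' j))"
    proof (rule sum.cong[OF refl])
      fix n
      have eq: "(\<Sum>l=1..m. U n l * (\<Sum>q'=1..m. g l q' * h q' j)) = (\<Sum>q'=1..m. (\<Sum>l=1..m. U n l * g l q') * h q' j)"
        unfolding sum_distrib_left sum_distrib_right by (subst sum.swap) (simp add: mult.assoc)
      show "e q n * (\<Sum>l=1..m. U n l * (\<Sum>q'=1..m. g l q' * h q' j))
         = (\<Sum>q'=1..m. e q n * ((\<Sum>l=1..m. U n l * g l q') * h q' j))"
        unfolding eq by (rule sum_distrib_left)
    qed
    also have "\<dots> = (\<Sum>q'=1..m. (\<Sum>n=1..m. e q n * (\<Sum>l=1..m. U n l * g l q')) * h q' j)"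
      by (subst sum.swap) (simp only: sum_distrib_right mult.assoc)
    also have "\<dots> = (\<Sum>q'=1..m. fps_const (of_bool (q = q')) * h q' j)"
      by (intro sum.cong arg_cong2[of _ _ _ _ "(*)"] dual refl)
    also have "\<dots> = (\<Sum>q'=1..m. if q' = q then h q' j else 0)"
      by (intro sum.cong) auto
    also have "\<dots> = h q j" using q by simp
    finally show ?thesis .
  qed
  have "e q 1 = (\<Sum>n=1..m. if n = 1 then e q n else 0)" using q by simp
  also have "\<dots> = (\<Sum>n=1..m. e q n * fps_const (of_bool (n = 1)))"
    by (intro sum.cong) auto
  also have "\<dots> = (\<Sum>n=1..m. e q n * (\<Sum>j=1..m. U n j * V j))"
    by (intro sum.cong arg_cong2[of _ _ _ _ "(*)"] UV[symmetric] refl)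
  also have "\<dots> = (\<Sum>j=1..m. (\<Sum>n=1..m. e q n * U n j) * V j)"
    unfolding sum_distrib_left sum_distrib_right by (subst sum.swap) (simp add: mult.assoc)
  also have "\<dots> = (\<Sum>j=1..m. h q j * V j)"
    by (intro sum.cong arg_cong2[of _ _ _ _ "(*)"] eU refl)
  finally have "fps_nth (e q 1) s = fps_nth (\<Sum>j=1..m. h q j * V j) s" by simp
  moreover have "fps_nth (e q 1) s = y q s x" using eta_1 by (simp add: e_def del: eta.simps)
  ultimately show ?thesis
    by (simp only: fps_sum_nth h_def V_def fps_mult_left_const_nth fps_nth_Abs_fps)
qed

section \<open>The Neumann series of the Volterra equation\<close>

lemma volterra_sum:
  assumes "\<And>i. i \<in> A \<Longrightarrow> continuous_on S (f i)" "x \<in> S"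
  shows "volterra (\<lambda>t. \<Sum>i\<in>A. w i * f i t) x = (\<Sum>i\<in>A. w i * volterra (f i) x)"
proof -
  have "J k (\<lambda>t. b k t * (\<Sum>i\<in>A. w i * f i t)) x = (\<Sum>i\<in>A. w i * J k (\<lambda>t. b k t * f i t) x)"
    if k: "k \<in> {1..m}" for k
  proof -
    have "J k (\<lambda>t. \<Sum>i\<in>A. w i * (b k t * f i t)) x = (\<Sum>i\<in>A. w i * J k (\<lambda>t. b k t * f i t) x)"
      using assms b_continuous[OF k] by (intro iter_int_sum continuous_intros) auto
    then show ?thesis by (simp add: sum_distrib_left mult_ac)
  qed
  then have "volterra (\<lambda>t. \<Sum>i\<in>A. w i * f i t) x
      = (\<Sum>k=1..m. \<Sum>i\<in>A. w i * ((-1) ^ k * J k (\<lambda>t. b k t * f i t) x))"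
    unfolding volterra_def by (intro sum.cong) (auto simp: sum_distrib_left mult_ac)
  also have "\<dots> = (\<Sum>i\<in>A. w i * volterra (f i) x)"
    unfolding volterra_def sum_distrib_left by (rule sum.swap)
  finally show ?thesis .
qed

lemma volterra_diff:
  assumes "continuous_on S f" "continuous_on S g" "x \<in> S"
  shows "volterra (\<lambda>t. f t - g t) x = volterra f x - volterra g x"
  using volterra_sum[of UNIV "\<lambda>i::bool. if i then f else g" x "\<lambda>i. if i then 1 else -1"] assms
  by (simp add: UNIV_bool)

lemma volterra_cong:
  assumes "continuous_on S f" "\<And>x. x \<in> S \<Longrightarrow> f x = g x" "x \<in> S"
  shows "volterra f x = volterra g x"
proof -
  have "J k (\<lambda>t. b k t * f t) x = J k (\<lambda>t. b k t * g t) x" if k: "k \<in> {1..m}" for k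
    using assms b_continuous[OF k] by (intro iter_int_cong continuous_intros) auto
  then show ?thesis unfolding volterra_def by (intro sum.cong) auto
qed

text \<open>
The constant \<open>L\<close> depends on the interval but not on \<open>f\<close>, so the bound can be iterated.
\<close>

lemma volterra_contracts:
  assumes ab: "a \<le> c" "c \<le> b'" "{a..b'} \<subseteq> S"
  obtains L where "L > 0"
    "\<And>f A t. \<lbrakk>continuous_on S f; \<And>t. t \<in> {a..b'} \<Longrightarrow> \<bar>f t\<bar> \<le> A * exp (L * \<bar>t - c\<bar>); t \<in> {a..b'}\<rbrakk>
       \<Longrightarrow> \<bar>volterra f t\<bar> \<le> A / 2 * exp (L * \<bar>t - c\<bar>)"
proof -
  let ?B = "\<lambda>t. \<Sum>k=1..m. \<bar>b k t\<bar>"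
  have "continuous_on {a..b'} ?B"
    using b_continuous ab by (intro continuous_intros) (auto intro: continuous_on_subset)
  from compact_imp_bounded[OF compact_continuous_image[OF this compact_Icc]]
  obtain \<beta> where \<beta>: "\<beta> > 0" "\<And>t. t \<in> {a..b'} \<Longrightarrow> \<bar>?B t\<bar> \<le> \<beta>"
    by (auto simp: bounded_pos)
  have bk: "\<bar>b k t\<bar> \<le> \<beta>" if "k \<in> {1..m}" "t \<in> {a..b'}" for k t
    using \<beta>(2)[OF that(2)] member_le_sum[OF that(1), of "\<lambda>k. \<bar>b k t\<bar>"] by simp
  \<comment> \<open>Each of the \<open>m\<close> summands contributes at most \<open>\<beta> / L\<close> because \<open>L \<ge> 1\<close>, and \<open>m * \<beta> / L \<le> 1 / 2\<close>.\<close>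
  define L where "L = 2 * real m * \<beta> + 1"
  have L: "L \<ge> 1" using \<beta>(1) by (simp add: L_def)
  have "\<bar>volterra f t\<bar> \<le> A / 2 * exp (L * \<bar>t - c\<bar>)"
    if f: "continuous_on S f" and bd: "\<And>t. t \<in> {a..b'} \<Longrightarrow> \<bar>f t\<bar> \<le> A * exp (L * \<bar>t - c\<bar>)"
      and t: "t \<in> {a..b'}" for f A t
  proof -
    have A: "A \<ge> 0" using bd[of c] ab by simp
    have "\<bar>volterra f t\<bar> \<le> (\<Sum>k=1..m. \<bar>(-1) ^ k * J k (\<lambda>t. b k t * f t) t\<bar>)"
      unfolding volterra_def by (rule sum_abs)
    also have "\<dots> \<le> (\<Sum>k=1..m. \<beta> * A / L * exp (L * \<bar>t - c\<bar>))"
    proof (rule sum_mono)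
      fix k assume k: "k \<in> {1..m}"
      have "\<bar>(-1) ^ k * J k (\<lambda>t. b k t * f t) t\<bar> \<le> \<beta> * A / L ^ k * exp (L * \<bar>t - c\<bar>)"
        unfolding abs_mult power_abs abs_neg_one power_one mult_1
      proof (rule iter_int_exp_bound[OF _ ab _ _ t])
        show "continuous_on S (\<lambda>t. b k t * f t)"
          using b_continuous[OF k] f by (intro continuous_intros)
        show "\<bar>b k t * f t\<bar> \<le> \<beta> * A * exp (L * \<bar>t - c\<bar>)" if "t \<in> {a..b'}" for t
          unfolding abs_mult mult.assoc using bk[OF k that] bd[OF that] \<beta>(1)
          by (intro mult_mono) auto
      qed (use L in simp)
      also have "\<dots> \<le> \<beta> * A / L * exp (L * \<bar>t - c\<bar>)"
        using L A \<beta>(1) k self_le_power[OF L, of k]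
        by (intro mult_right_mono divide_left_mono) auto
      finally show "\<bar>(-1) ^ k * J k (\<lambda>t. b k t * f t) t\<bar> \<le> \<beta> * A / L * exp (L * \<bar>t - c\<bar>)" .
    qed
    also have "\<dots> = (real m * \<beta> / L) * (A * exp (L * \<bar>t - c\<bar>))" by simp
    also have "\<dots> \<le> (1 / 2) * (A * exp (L * \<bar>t - c\<bar>))"
      using A L by (intro mult_right_mono) (auto simp: L_def field_simps)
    finally show ?thesis by simp
  qed
  then show ?thesis using that[of L] L by auto
qed

lemma continuous_exp_bounded:
  assumes "continuous_on S f" "{a..b'} \<subseteq> S" "L > 0"
  obtains A where "\<And>t. t \<in> {a..b'} \<Longrightarrow> \<bar>f t\<bar> \<le> A * exp (L * \<bar>t - c\<bar>)"
proof -
  from compact_imp_bounded[OF compact_continuous_image[OF continuous_on_subset[OF assms(1,2)] compact_Icc]]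
  obtain A where A: "A > 0" "\<And>t. t \<in> {a..b'} \<Longrightarrow> \<bar>f t\<bar> \<le> A"
    by (auto simp: bounded_pos)
  have "\<bar>f t\<bar> \<le> A * exp (L * \<bar>t - c\<bar>)" if "t \<in> {a..b'}" for t
  proof -
    have "A * 1 \<le> A * exp (L * \<bar>t - c\<bar>)" using A(1) assms(3) by (intro mult_left_mono) auto
    then show ?thesis using A(2)[OF that] by linarith
  qed
  then show ?thesis using that by blast
qed

lemma volterra_unique:
  assumes D: "continuous_on S D" "\<And>x. x \<in> S \<Longrightarrow> D x = volterra D x" and x: "x \<in> S"
  shows "D x = 0"
proof -
  obtain a b' where ab: "a < x" "x < b'" "a < c" "c < b'" "{a..b'} \<subseteq> S"
    using compact_neighbourhood[OF x] .
  obtain L where L: "L > 0"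
    "\<And>f A t. \<lbrakk>continuous_on S f; \<And>t. t \<in> {a..b'} \<Longrightarrow> \<bar>f t\<bar> \<le> A * exp (L * \<bar>t - c\<bar>); t \<in> {a..b'}\<rbrakk>
       \<Longrightarrow> \<bar>volterra f t\<bar> \<le> A / 2 * exp (L * \<bar>t - c\<bar>)"
    using volterra_contracts[of a b'] ab by (metis less_imp_le)
  obtain A where A: "\<And>t. t \<in> {a..b'} \<Longrightarrow> \<bar>D t\<bar> \<le> A * exp (L * \<bar>t - c\<bar>)"
    using continuous_exp_bounded[OF D(1) ab(5) L(1)] by blast
  have B: "\<bar>D t\<bar> \<le> A / 2 ^ n * exp (L * \<bar>t - c\<bar>)" if "t \<in> {a..b'}" for n t
    using that
  proof (induction n arbitrary: t)
    case (Suc n)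
    then show ?case using L(2)[OF D(1), of "A / 2 ^ n" t] D(2)[of t] ab(5) by (auto simp: field_simps)
  qed (use A in simp)
  have "(\<lambda>n. (A * exp (L * \<bar>x - c\<bar>)) * (1 / 2) ^ n) \<longlonglongrightarrow> (A * exp (L * \<bar>x - c\<bar>)) * 0"
    by (intro tendsto_intros LIMSEQ_power_zero) auto
  then have "\<bar>D x\<bar> \<le> (A * exp (L * \<bar>x - c\<bar>)) * 0"
    by (rule LIMSEQ_le_const) (use B[of x] ab in \<open>auto simp: field_simps\<close>)
  then show ?thesis by simp
qed

lemma y_geometric_bound:
  assumes ab: "a < c" "c < b'" "{a..b'} \<subseteq> S"
  obtains A L where "L > 0"
    "\<And>f A t. \<lbrakk>continuous_on S f; \<And>t. t \<in> {a..b'} \<Longrightarrow> \<bar>f t\<bar> \<le> A * exp (L * \<bar>t - c\<bar>); t \<in> {a..b'}\<rbrakk>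
       \<Longrightarrow> \<bar>volterra f t\<bar> \<le> A / 2 * exp (L * \<bar>t - c\<bar>)"
    "\<And>s t. t \<in> {a..b'} \<Longrightarrow> \<bar>y q s t\<bar> \<le> A * exp (L * \<bar>t - c\<bar>) * (1 / 2) ^ s"
proof -
  obtain L where L: "L > 0"
    "\<And>f A t. \<lbrakk>continuous_on S f; \<And>t. t \<in> {a..b'} \<Longrightarrow> \<bar>f t\<bar> \<le> A * exp (L * \<bar>t - c\<bar>); t \<in> {a..b'}\<rbrakk>
       \<Longrightarrow> \<bar>volterra f t\<bar> \<le> A / 2 * exp (L * \<bar>t - c\<bar>)"
    using volterra_contracts[of a b'] ab by (metis less_imp_le)
  obtain A where A: "\<And>t. t \<in> {a..b'} \<Longrightarrow> \<bar>y q 0 t\<bar> \<le> A * exp (L * \<bar>t - c\<bar>)"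
    using continuous_exp_bounded[OF y_continuous ab(3) L(1)] by blast
  have "\<bar>y q s t\<bar> \<le> A * (1 / 2) ^ s * exp (L * \<bar>t - c\<bar>)" if "t \<in> {a..b'}" for s t
    using that
  proof (induction s arbitrary: t)
    case (Suc s)
    then show ?case using L(2)[OF y_continuous, of q s "A * (1 / 2) ^ s" t] by simp
  qed (use A in simp)
  then have "\<bar>y q s t\<bar> \<le> A * exp (L * \<bar>t - c\<bar>) * (1 / 2) ^ s" if "t \<in> {a..b'}" for s t
    using that by (simp only: mult_ac)
  then show ?thesis using that[OF L] by blast
qed

definition neumann :: "nat \<Rightarrow> real \<Rightarrow> real" where
  "neumann q x = (\<Sum>s. y q s x)"

lemma
  assumes x: "x \<in> S"
  shows y_summable: "summable (\<lambda>s. y q s x)"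
    and neumann_isCont: "isCont (neumann q) x"
proof -
  obtain a b' where ab: "a < x" "x < b'" "a < c" "c < b'" "{a..b'} \<subseteq> S"
    using compact_neighbourhood[OF x] .
  obtain A L where L: "L > 0"
    "\<And>s t. t \<in> {a..b'} \<Longrightarrow> \<bar>y q s t\<bar> \<le> A * exp (L * \<bar>t - c\<bar>) * (1 / 2) ^ s"
    using y_geometric_bound[OF ab(3-5)] by metis
  have A: "A \<ge> 0" using L(2)[of c 0] ab by auto
  define M where "M = A * exp (L * (b' - a))"
  have bd: "norm (y q s t) \<le> M * (1 / 2) ^ s" if "t \<in> {a..b'}" for s t
  proof -
    have "\<bar>t - c\<bar> \<le> b' - a" using that ab by auto
    then have "A * exp (L * \<bar>t - c\<bar>) * (1 / 2) ^ s \<le> M * (1 / 2) ^ s"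
      unfolding M_def using A L(1) by (intro mult_right_mono mult_left_mono) auto
    then show ?thesis unfolding real_norm_def by (rule order_trans[OF L(2)[OF that]])
  qed
  have M: "summable (\<lambda>s. M * (1 / 2) ^ s)" by (intro summable_mult summable_geometric) simp
  show "summable (\<lambda>s. y q s x)"
    using summable_comparison_test'[OF M, of 0 "\<lambda>s. y q s x"] bd[of x] ab by auto
  have "uniform_limit {a..b'} (\<lambda>n x. \<Sum>s<n. y q s x) (\<lambda>x. \<Sum>s. y q s x) sequentially"
    by (rule Weierstrass_m_test[OF bd M])
  then have "continuous_on {a..b'} (\<lambda>x. \<Sum>s. y q s x)"
    by (rule uniform_limit_theorem[rotated])
      (use ab(5) in \<open>auto intro!: always_eventually continuous_intros continuous_on_subset[OF y_continuous]\<close>)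
  then have "isCont (\<lambda>x. \<Sum>s. y q s x) x"
    using continuous_on_interior[of "{a..b'}" "\<lambda>x. \<Sum>s. y q s x" x] ab by simp
  then show "isCont (neumann q) x" unfolding neumann_def[abs_def] .
qed

lemma neumann_continuous: "continuous_on S (neumann q)"
  using neumann_isCont continuous_at_imp_continuous_on by blast

text \<open>
Apply \<open>volterra\<close> to the remainders of the series: they are continuous and decay geometrically in the
weighted norm, so their images tend to \<open>0\<close> and the operator may be applied termwise.
\<close>

lemma neumann_volterra:
  assumes x: "x \<in> S"
  shows "neumann q x = taylor (- x) q 1 + volterra (neumann q) x"
proof -
  obtain a b' where ab: "a < x" "x < b'" "a < c" "c < b'" "{a..b'} \<subseteq> S"
    using compact_neighbourhood[OF x] .
  obtain A L where L: "L > 0"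
    "\<And>f A t. \<lbrakk>continuous_on S f; \<And>t. t \<in> {a..b'} \<Longrightarrow> \<bar>f t\<bar> \<le> A * exp (L * \<bar>t - c\<bar>); t \<in> {a..b'}\<rbrakk>
       \<Longrightarrow> \<bar>volterra f t\<bar> \<le> A / 2 * exp (L * \<bar>t - c\<bar>)"
    "\<And>s t. t \<in> {a..b'} \<Longrightarrow> \<bar>y q s t\<bar> \<le> A * exp (L * \<bar>t - c\<bar>) * (1 / 2) ^ s"
    using y_geometric_bound[OF ab(3-5)] by metis
  let ?R = "\<lambda>N t. neumann q t - (\<Sum>s<N. 1 * y q s t)"
  have R: "\<bar>?R N t\<bar> \<le> (2 * A * (1 / 2) ^ N) * exp (L * \<bar>t - c\<bar>)" if t: "t \<in> {a..b'}" for N t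
  proof -
    let ?M = "A * exp (L * \<bar>t - c\<bar>) * (1 / 2) ^ N"
    have "t \<in> S" using t ab(5) by blast
    have "?R N t = (\<Sum>s. y q (s + N) t)"
      using suminf_minus_initial_segment[OF y_summable[OF \<open>t \<in> S\<close>], of q N] by (simp add: neumann_def)
    moreover have "norm (\<Sum>s. y q (s + N) t) \<le> (\<Sum>s. ?M * (1 / 2) ^ s)"
    proof (intro norm_suminf_le summable_mult summable_geometric)
      fix s
      have "\<bar>y q (s + N) t\<bar> \<le> A * exp (L * \<bar>t - c\<bar>) * (1 / 2) ^ (s + N)" by (rule L(3)[OF t])
      then show "norm (y q (s + N) t) \<le> ?M * (1 / 2) ^ s"
        by (simp only: power_add real_norm_def mult_ac)
    qed simp
    moreover have "(\<Sum>s. ?M * (1 / 2) ^ s) = ?M * 2"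
      by (subst suminf_mult) (auto simp: suminf_geometric)
    moreover have "?M * 2 = (2 * A * (1 / 2) ^ N) * exp (L * \<bar>t - c\<bar>)" by (simp only: mult_ac)
    ultimately show ?thesis by simp
  qed
  have Rc: "continuous_on S (?R N)" for N
    by (intro continuous_intros neumann_continuous y_continuous)
  have KR: "volterra (?R N) x = volterra (neumann q) x - (\<Sum>s<N. y q (Suc s) x)" for N
  proof -
    have "volterra (?R N) x = volterra (neumann q) x - volterra (\<lambda>t. \<Sum>s<N. 1 * y q s t) x"
      by (intro volterra_diff neumann_continuous x continuous_intros y_continuous)
    then show ?thesis using volterra_sum[of "{..<N}" "y q" x "\<lambda>_. 1"] y_continuous x by simp
  qed
  have "\<bar>volterra (?R N) x\<bar> \<le> (2 * A * (1 / 2) ^ N) / 2 * exp (L * \<bar>x - c\<bar>)" for N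
    using L(2)[OF Rc R, of x N] ab by auto
  then have "\<forall>N. norm (volterra (?R N) x) \<le> (A * exp (L * \<bar>x - c\<bar>)) * (1 / 2) ^ N"
    by (simp add: mult_ac)
  moreover have "(\<lambda>N. (A * exp (L * \<bar>x - c\<bar>)) * (1 / 2) ^ N) \<longlonglongrightarrow> 0"
    by (intro tendsto_mult_right_zero LIMSEQ_power_zero) simp
  ultimately have "(\<lambda>N. volterra (?R N) x) \<longlonglongrightarrow> 0"
    by (rule Lim_null_comparison[OF always_eventually])
  then have "(\<lambda>N. volterra (neumann q) x - volterra (?R N) x) \<longlonglongrightarrow> volterra (neumann q) x - 0"
    by (intro tendsto_intros)
  then have "(\<lambda>s. y q (Suc s) x) sums volterra (neumann q) x"
    unfolding KR sums_def by simp
  then have "(\<lambda>s. y q s x) sums (volterra (neumann q) x + y q 0 x)"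
    by (subst (asm) sums_Suc_iff) simp
  then show ?thesis by (simp add: neumann_def sums_iff)
qed

text \<open>
Existence is \<open>neumann_volterra\<close> and linearity; uniqueness holds because the difference of two solutions
with the same inhomogeneity is a fixed point of \<open>volterra\<close>, hence \<open>0\<close>.
\<close>

lemma volterra_solutions:
  assumes Y: "continuous_on S Y"
  shows "(\<forall>x\<in>S. Y x = (\<Sum>q=1..m. C q * taylor (- x) q 1) + volterra Y x) \<longleftrightarrow>
    (\<forall>x\<in>S. Y x = (\<Sum>q=1..m. C q * neumann q x))"
proof -
  let ?Z = "\<lambda>x. \<Sum>q=1..m. C q * neumann q x"
  have Zc: "continuous_on S ?Z" by (intro continuous_intros neumann_continuous)
  have Z: "?Z x = (\<Sum>q=1..m. C q * taylor (- x) q 1) + volterra ?Z x" if x: "x \<in> S" for x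
  proof -
    have "?Z x = (\<Sum>q=1..m. C q * taylor (- x) q 1 + C q * volterra (neumann q) x)"
      by (subst neumann_volterra[OF x]) (simp only: distrib_left)
    then show ?thesis
      using volterra_sum[of "{1..m}" neumann x C] neumann_continuous x by (simp only: sum.distrib)
  qed
  show ?thesis
  proof
    assume "\<forall>x\<in>S. Y x = (\<Sum>q=1..m. C q * taylor (- x) q 1) + volterra Y x"
    then have D: "Y x - ?Z x = volterra (\<lambda>t. Y t - ?Z t) x" if "x \<in> S" for x
      using volterra_diff[OF Y Zc that] Z[OF that] that by simp
    have "Y x - ?Z x = 0" if "x \<in> S" for x
      using volterra_unique[OF continuous_on_diff[OF Y Zc] D that] .
    then show "\<forall>x\<in>S. Y x = ?Z x" by simp
  next
    assume "\<forall>x\<in>S. Y x = ?Z x"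
    then have YZ: "Y x = ?Z x" if "x \<in> S" for x using that by blast
    show "\<forall>x\<in>S. Y x = (\<Sum>q=1..m. C q * taylor (- x) q 1) + volterra Y x"
    proof
      fix x assume x: "x \<in> S"
      show "Y x = (\<Sum>q=1..m. C q * taylor (- x) q 1) + volterra Y x"
        using YZ[OF x] Z[OF x] volterra_cong[OF Y YZ x] by linarith
    qed
  qed
qed

end

section \<open>The multiple sums behind the adjoint iterates\<close>

lemma sum_PiE_lessThan_Suc:
  "(\<Sum>f\<in>{..<Suc r} \<rightarrow>\<^sub>E A. g f) = (\<Sum>a\<in>A. \<Sum>f\<in>{..<r} \<rightarrow>\<^sub>E A. g (f(r := a)))"
proof -
  have "(\<Sum>f\<in>{..<Suc r} \<rightarrow>\<^sub>E A. g f) = (\<Sum>(a, f)\<in>A \<times> ({..<r} \<rightarrow>\<^sub>E A). g (f(r := a)))"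
    unfolding lessThan_Suc PiE_insert_eq
    by (subst sum.reindex[OF inj_combinator]) (auto simp: case_prod_unfold)
  then show ?thesis by (simp add: sum.cartesian_product)
qed

text \<open>
The summation range of \<open>T_fun\<close>. Functions that are undefined outside \<open>{..<r}\<close> represent the tuples, and
splitting off the last entry (\<open>sum_bounded_tuples_Suc\<close>) lowers the bound for the others.
\<close>

definition bounded_tuples :: "nat \<Rightarrow> nat \<Rightarrow> (nat \<Rightarrow> nat) set" where
  "bounded_tuples r M = {i \<in> {..<r} \<rightarrow>\<^sub>E UNIV. (\<Sum>l<r. i l) \<le> M}"

lemma finite_bounded_tuples: "finite (bounded_tuples r M)"
proof (rule finite_subset)
  show "bounded_tuples r M \<subseteq> {..<r} \<rightarrow>\<^sub>E {..M}"
  proof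
    fix i assume i: "i \<in> bounded_tuples r M"
    have "i l \<le> M" if "l < r" for l
      using member_le_sum[of l "{..<r}" i] i that by (auto simp: bounded_tuples_def)
    then show "i \<in> {..<r} \<rightarrow>\<^sub>E {..M}"
      using i by (auto simp: bounded_tuples_def PiE_iff)
  qed
qed (auto intro: finite_PiE)

lemma sum_bounded_tuples_Suc:
  "(\<Sum>i\<in>bounded_tuples (Suc r) M. g i) =
    (\<Sum>a\<le>M. \<Sum>i\<in>bounded_tuples r (M - a). g (i(r := a)))"
proof -
  have "(\<Sum>a\<le>M. \<Sum>i\<in>bounded_tuples r (M - a). g (i(r := a)))
      = (\<Sum>(a, i)\<in>(SIGMA a:{..M}. bounded_tuples r (M - a)). g (i(r := a)))"
    by (subst sum.Sigma) (auto simp: finite_bounded_tuples)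
  also have "\<dots> = (\<Sum>i\<in>bounded_tuples (Suc r) M. g i)"
  proof (rule sum.reindex_bij_witness[of _ "\<lambda>i. (i r, i(r := undefined))" "\<lambda>(a, i). i(r := a)"])
    fix p assume "p \<in> (SIGMA a:{..M}. bounded_tuples r (M - a))"
    then show "(\<lambda>(a, i). i(r := a)) p \<in> bounded_tuples (Suc r) M"
      and "(\<lambda>i. (i r, i(r := undefined))) ((\<lambda>(a, i). i(r := a)) p) = p"
      by (auto simp: bounded_tuples_def PiE_iff extensional_def fun_eq_iff)
  next
    fix i assume "i \<in> bounded_tuples (Suc r) M"
    then show "(i r, i(r := undefined)) \<in> (SIGMA a:{..M}. bounded_tuples r (M - a))"
      and "(\<lambda>(a, i). i(r := a)) (i r, i(r := undefined)) = i"
      by (auto simp: bounded_tuples_def PiE_iff extensional_def fun_eq_iff)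
  qed auto
  finally show ?thesis ..
qed

context adjoint_system begin

text \<open>
\<open>B_seq\<close> with its starting function as a parameter. There the start involves all of \<open>i\<^sub>0, \<dots>, i\<^sub>r\<close>, also
those that do not occur in the integrations so far; separating the two dependences makes an induction
on the length of the tuples possible.
\<close>

primrec nested :: "(real \<Rightarrow> real) \<Rightarrow> (nat \<Rightarrow> nat) \<Rightarrow> (nat \<Rightarrow> nat) \<Rightarrow> nat \<Rightarrow> real \<Rightarrow> real" where
  "nested f i k 0 = f"
| "nested f i k (Suc l) = (\<lambda>x. J (i l + k l) (nested f i k l) x * b (k l) x)"

lemma nested_cong:
  assumes "\<And>l'. l' < l \<Longrightarrow> i l' = i' l' \<and> k l' = k' l'"
  shows "nested f i k l = nested f i' k' l"
  using assms by (induction l) auto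

lemma nested_continuous:
  assumes "continuous_on S f" "\<And>l'. l' < l \<Longrightarrow> k l' \<in> {1..m}"
  shows "continuous_on S (nested f i k l)"
  using assms(2)
proof (induction l)
  case (Suc l)
  then show ?case
    by (auto intro!: continuous_intros iter_int_continuous b_continuous simp: less_Suc_eq)
qed (use assms in simp)

definition weight :: "nat \<Rightarrow> (nat \<Rightarrow> nat) \<Rightarrow> (nat \<Rightarrow> nat) \<Rightarrow> real" where
  "weight r i k = (-1) ^ (\<Sum>l<r. i l) * (\<Prod>l<r. real ((k l - 1 + i l) choose (k l - 1)))"

lemma weight_Suc:
  assumes "a \<ge> 1"
  shows "weight (Suc r) (i(r := s)) (k(r := a)) = (- real a gchoose s) * weight r i k"
proof -
  have "(- real a gchoose s) = (-1) ^ s * real ((a - 1 + s) choose (a - 1))"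
  proof -
    obtain d where d: "a = Suc d" using assms by (cases a) auto
    have "real a + real s - 1 = real (d + s)" by (simp add: d)
    then show ?thesis
      using binomial_symmetric[of d "d + s"]
      by (simp only: gbinomial_minus binomial_gbinomial[symmetric]) (simp add: d)
  qed
  moreover have "(\<Sum>l<r. (i(r := s)) l) = (\<Sum>l<r. i l)"
    "(\<Prod>l<r. real (((k(r := a)) l - 1 + (i(r := s)) l) choose ((k(r := a)) l - 1)))
      = (\<Prod>l<r. real ((k l - 1 + i l) choose (k l - 1)))"
    by (auto intro!: sum.cong prod.cong)
  ultimately show ?thesis by (simp add: weight_def power_add)
qed

text \<open>
Integrate the expansion of \<open>kernel\<close> termwise. The expansion is a hypothesis because it is itself
proved by induction on \<open>r\<close>, and its step needs the present conclusion for the preceding \<open>r\<close>.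
\<close>

lemma T_eq_sum_nested_step:
  assumes j: "j \<in> {1..m}" and x: "x \<in> S"
    and kernel: "\<And>p x. \<lbrakk>p \<in> {1..m}; x \<in> S\<rbrakk> \<Longrightarrow> kernel r p x =
      (\<Sum>i\<in>bounded_tuples r (m - p). \<Sum>k\<in>{..<r} \<rightarrow>\<^sub>E {1..m}.
        weight r i k * nested (b (p + (\<Sum>l<r. i l))) i k r x)"
  shows "T r n j x = (\<Sum>s\<le>m - j. \<Sum>i\<in>bounded_tuples r (m - j - s). \<Sum>k\<in>{..<r} \<rightarrow>\<^sub>E {1..m}.
     (- real n gchoose s) * (weight r i k * J (n + s) (nested (b (j + s + (\<Sum>l<r. i l))) i k r) x))"
proof -
  let ?I = "\<lambda>a. bounded_tuples r (m - j - a)" and ?P = "{..<r} \<rightarrow>\<^sub>E {1..m}"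
  let ?N = "\<lambda>a i k. nested (b (j + a + (\<Sum>l<r. i l))) i k r"
  have N: "continuous_on S (?N a i k)" if "a \<le> m - j" "i \<in> ?I a" "k \<in> ?P" for a i k
    using that j
    by (intro nested_continuous b_continuous) (auto simp: bounded_tuples_def PiE_iff)
  have "J q (kernel r (j + a)) x = (\<Sum>i\<in>?I a. \<Sum>k\<in>?P. weight r i k * J q (?N a i k) x)"
    if a: "a \<le> m - j" for a q
  proof -
    have p: "j + a \<in> {1..m}" using a j by auto
    have "J q (kernel r (j + a)) x = J q (\<lambda>x. \<Sum>i\<in>?I a. \<Sum>k\<in>?P. weight r i k * ?N a i k x) x"
      using kernel[OF p] by (intro iter_int_cong kernel_continuous p x) simp
    also have "\<dots> = J q (\<lambda>x. \<Sum>i\<in>?I a. 1 * (\<Sum>k\<in>?P. weight r i k * ?N a i k x)) x" by simp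
    also have "\<dots> = (\<Sum>i\<in>?I a. 1 * J q (\<lambda>x. \<Sum>k\<in>?P. weight r i k * ?N a i k x) x)"
      using N a by (intro iter_int_sum x continuous_intros) auto
    also have "\<dots> = (\<Sum>i\<in>?I a. 1 * (\<Sum>k\<in>?P. weight r i k * J q (?N a i k) x))"
      using N a by (intro sum.cong refl arg_cong2[of _ _ _ _ "(*)"] iter_int_sum x) auto
    finally show ?thesis by simp
  qed
  then show ?thesis using j by (simp add: T_altdef sum_distrib_left)
qed

lemma kernel_eq_sum_nested:
  assumes "p \<in> {1..m}" "x \<in> S"
  shows "kernel r p x = (\<Sum>i\<in>bounded_tuples r (m - p). \<Sum>k\<in>{..<r} \<rightarrow>\<^sub>E {1..m}.
     weight r i k * nested (b (p + (\<Sum>l<r. i l))) i k r x)"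
  using assms
proof (induction r arbitrary: p x)
  case 0
  have "bounded_tuples 0 (m - p) = {\<lambda>_. undefined}" by (auto simp: bounded_tuples_def)
  then show ?case by (simp add: weight_def)
next
  case (Suc r)
  let ?I = "\<lambda>a. bounded_tuples r (m - p - a)" and ?P = "{..<r} \<rightarrow>\<^sub>E {1..m}"
  let ?N = "\<lambda>a i k. nested (b (p + a + (\<Sum>l<r. i l))) i k r"
  let ?g = "\<lambda>d a i k. weight (Suc r) (i(r := a)) (k(r := d)) *
      nested (b (p + (\<Sum>l<Suc r. (i(r := a)) l))) (i(r := a)) (k(r := d)) (Suc r) x"
  have g: "b d x * ((- real d gchoose a) * (weight r i k * J (d + a) (?N a i k) x)) = ?g d a i k"
    if "d \<in> {1..m}" for d a i k
  proof -
    have "nested f (i(r := a)) (k(r := d)) r = nested f i k r" for f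
      by (rule nested_cong) auto
    moreover have "(\<Sum>l<Suc r. (i(r := a)) l) = a + (\<Sum>l<r. i l)"
      by (auto intro!: sum.cong)
    ultimately show ?thesis using that by (simp add: weight_Suc add_ac)
  qed
  have T: "T r n p x = (\<Sum>a\<le>m - p. \<Sum>i\<in>?I a. \<Sum>k\<in>?P.
      (- real n gchoose a) * (weight r i k * J (n + a) (?N a i k) x))" for n
    by (rule T_eq_sum_nested_step[OF Suc.prems]) (rule Suc.IH)
  have "kernel (Suc r) p x = (\<Sum>d=1..m. \<Sum>a\<le>m - p. \<Sum>i\<in>?I a. \<Sum>k\<in>?P.
      b d x * ((- real d gchoose a) * (weight r i k * J (d + a) (?N a i k) x)))"
    using Suc.prems(1)
    by (simp only: kernel_Suc atLeastAtMost_iff T sum_distrib_left)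
  also have "\<dots> = (\<Sum>d=1..m. \<Sum>a\<le>m - p. \<Sum>i\<in>?I a. \<Sum>k\<in>?P. ?g d a i k)"
    by (intro sum.cong refl g)
  also have "\<dots> = (\<Sum>a\<le>m - p. \<Sum>i\<in>?I a. \<Sum>d=1..m. \<Sum>k\<in>?P. ?g d a i k)"
    by (subst sum.swap, rule sum.cong[OF refl], rule sum.swap)
  finally show ?case
    unfolding sum_bounded_tuples_Suc sum_PiE_lessThan_Suc .
qed

lemma T_eq_sum_nested:
  assumes "j \<in> {1..m}" "x \<in> S"
  shows "T r n j x = (\<Sum>s\<le>m - j. \<Sum>i\<in>bounded_tuples r (m - j - s). \<Sum>k\<in>{..<r} \<rightarrow>\<^sub>E {1..m}.
     (- real n gchoose s) * (weight r i k * J (n + s) (nested (b (j + s + (\<Sum>l<r. i l))) i k r) x))"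
  using assms kernel_eq_sum_nested by (rule T_eq_sum_nested_step)

end

locale ode_coefficients = adjoint_system S c m "b_coeff m a" for S c m a
begin

lemma B_seq_eq_nested: "l \<le> r \<Longrightarrow> B_seq m a c j r i k l = nested (b_coeff m a (j + (\<Sum>l\<le>r. i l))) i k l"
  by (induction l) auto

lemma T_fun_eq_T:
  assumes j: "j \<in> {1..m}" and x: "x \<in> S"
  shows "T_fun m a c r n j x = T r n j x"
proof -
  let ?P = "{..<r} \<rightarrow>\<^sub>E {1..m}"
  let ?g = "\<lambda>i. (-1) ^ (\<Sum>l<r. i l) * ((- real n) gchoose (i r)) *
        (\<Sum>k \<in> ?P. (\<Prod>l<r. real ((k l - 1 + i l) choose (k l - 1))) *
           J (n + i r) (B_seq m a c j r i k r) x)"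
  have "T_fun m a c r n j x = (\<Sum>i\<in>bounded_tuples (Suc r) (m - j). ?g i)"
    unfolding T_fun_def bounded_tuples_def lessThan_Suc_atMost by (simp only: Collect_conj_eq[symmetric])
  also have "\<dots> = (\<Sum>s\<le>m - j. \<Sum>i\<in>bounded_tuples r (m - j - s). ?g (i(r := s)))"
    by (rule sum_bounded_tuples_Suc)
  also have "\<dots> = T r n j x"
    unfolding T_eq_sum_nested[OF j x]
  proof (intro sum.cong refl)
    fix s i
    have [simp]: "nested f (i(r := s)) k r = nested f i k r" for f k
      by (rule nested_cong) auto
    have [simp]: "(\<Sum>l\<le>r. (i(r := s)) l) = s + (\<Sum>l<r. i l)"
      unfolding lessThan_Suc_atMost[symmetric] by (auto intro!: sum.cong)
    have [simp]: "(\<Sum>l<r. (i(r := s)) l) = (\<Sum>l<r. i l)"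
      "(\<Prod>l<r. real ((k l - Suc 0 + (i(r := s)) l) choose (k l - Suc 0))) = (\<Prod>l<r. real ((k l - 1 + i l) choose (k l - 1)))" for k
      by (auto intro!: sum.cong prod.cong)
    show "?g (i(r := s)) = (\<Sum>k\<in>?P. (- real n gchoose s) * (weight r i k *
        J (n + s) (nested (b_coeff m a (j + s + (\<Sum>l<r. i l))) i k r) x))"
      unfolding sum_distrib_left
      by (intro sum.cong refl) (simp add: B_seq_eq_nested weight_def mult_ac add.assoc fun_upd_same del: fun_upd_apply)
  qed
  finally show ?thesis .
qed

end

section \<open>Integration by parts modulo polynomials\<close>

context base_interval begin

abbreviation Cn where "Cn n f \<equiv> times_cont_differentiable_on n f S"

text \<open>
The following rules describe \<open>times_cont_differentiable_on\<close> by induction on the order.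
\<close>

lemma Cn_0 [simp]: "Cn 0 f \<longleftrightarrow> continuous_on S f"
  by (simp add: times_cont_differentiable_on_def times_differentiable_on_def)

lemma Cn_Suc: "Cn (Suc n) f \<longleftrightarrow> f differentiable_on S \<and> Cn n (deriv f)"
  unfolding times_cont_differentiable_on_def times_differentiable_on_def
  by (auto simp: All_less_Suc2 funpow_swap1)

lemma has_deriv:
  assumes "f differentiable_on S" "x \<in> S"
  shows "(f has_real_derivative deriv f x) (at x)"
  using assms open_S
  by (simp add: DERIV_deriv_iff_real_differentiable differentiable_on_eq_differentiable_at)

lemma deriv_cong_on:
  assumes "\<And>x. x \<in> S \<Longrightarrow> f x = g x" "x \<in> S"
  shows "deriv f x = deriv g x"
proof (rule deriv_cong_ev[OF _ refl])
  show "\<forall>\<^sub>F x in nhds x. f x = g x"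
    using eventually_nhds_in_open[OF open_S assms(2)] assms(1) by (auto elim: eventually_mono)
qed

lemma differentiable_onI:
  assumes "\<And>x. x \<in> S \<Longrightarrow> (f has_real_derivative f' x) (at x)"
  shows "f differentiable_on S"
  unfolding differentiable_on_def real_differentiable_def
  using assms has_field_derivative_at_within by blast

lemma Cn_cong:
  assumes "\<And>x. x \<in> S \<Longrightarrow> f x = g x" "Cn n f"
  shows "Cn n g"
  using assms
proof (induction n arbitrary: f g)
  case (Suc n)
  have "g differentiable_on S"
  proof (rule differentiable_onI)
    fix x assume x: "x \<in> S"
    have "(f has_real_derivative deriv f x) (at x)"
      using Suc.prems(2) x by (simp add: Cn_Suc has_deriv)
    then show "(g has_real_derivative deriv f x) (at x)"
      by (rule has_field_derivative_transform_within_open[OF _ open_S x Suc.prems(1)])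
  qed
  moreover have "Cn n (deriv g)"
  proof (rule Suc.IH)
    show "deriv f x = deriv g x" if "x \<in> S" for x
      using Suc.prems(1) that by (rule deriv_cong_on)
    show "Cn n (deriv f)" using Suc.prems(2) by (simp add: Cn_Suc)
  qed
  ultimately show ?case by (simp add: Cn_Suc)
qed (use continuous_on_cong in auto)

lemma Cn_SucI:
  assumes "\<And>x. x \<in> S \<Longrightarrow> (f has_real_derivative f' x) (at x)" "Cn n f'"
  shows "Cn (Suc n) f"
proof -
  have "f differentiable_on S"
    by (rule differentiable_onI[OF assms(1)])
  moreover have "Cn n (deriv f)"
    using assms DERIV_imp_deriv by (intro Cn_cong[OF _ assms(2)]) force
  ultimately show ?thesis by (simp add: Cn_Suc)
qed

lemma Cn_Suc_D: "Cn (Suc n) f \<Longrightarrow> Cn n f"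
  by (induction n arbitrary: f) (auto simp: Cn_Suc differentiable_imp_continuous_on)

lemma Cn_mono: "n \<le> k \<Longrightarrow> Cn k f \<Longrightarrow> Cn n f"
  by (induction k rule: dec_induct) (auto dest: Cn_Suc_D)

lemma Cn_continuous: "Cn n f \<Longrightarrow> continuous_on S f"
  using Cn_mono[of 0 n f] by simp

lemma Cn_const: "Cn n (\<lambda>_. k)"
proof (induction n arbitrary: k)
  case (Suc n)
  show ?case using Suc[of 0] by (intro Cn_SucI[of _ "\<lambda>_. 0"]) auto
qed auto

lemma Cn_add: "Cn n f \<Longrightarrow> Cn n g \<Longrightarrow> Cn n (\<lambda>x. f x + g x)"
proof (induction n arbitrary: f g)
  case (Suc n)
  then show ?case
    by (intro Cn_SucI[of _ "\<lambda>x. deriv f x + deriv g x"]) (auto simp: Cn_Suc intro: DERIV_add has_deriv)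
qed (auto intro: continuous_intros)

lemma Cn_mult: "Cn n f \<Longrightarrow> Cn n g \<Longrightarrow> Cn n (\<lambda>x. f x * g x)"
proof (induction n arbitrary: f g)
  case (Suc n)
  show ?case
  proof (rule Cn_SucI)
    show "((\<lambda>x. f x * g x) has_real_derivative deriv f x * g x + f x * deriv g x) (at x)" if "x \<in> S" for x
      using DERIV_mult[OF has_deriv has_deriv, of f x g] Suc.prems that
      by (simp add: Cn_Suc algebra_simps)
    show "Cn n (\<lambda>x. deriv f x * g x + f x * deriv g x)"
      using Suc.prems Cn_Suc_D[OF Suc.prems(1)] Cn_Suc_D[OF Suc.prems(2)]
      by (intro Cn_add Suc.IH) (auto simp: Cn_Suc)
  qed
qed (auto intro: continuous_intros)

lemma Cn_sum: "(\<And>i. i \<in> A \<Longrightarrow> Cn n (f i)) \<Longrightarrow> Cn n (\<lambda>x. \<Sum>i\<in>A. f i x)"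
  by (induction A rule: infinite_finite_induct) (auto intro: Cn_add Cn_const)

lemma Cn_power: "Cn n (\<lambda>x. x ^ i)"
proof (induction i)
  case (Suc i)
  have "Cn n (\<lambda>x. x)"
    by (cases n) (auto intro!: Cn_SucI[of _ "\<lambda>_. 1"] Cn_const continuous_intros)
  then show ?case using Cn_mult[OF _ Suc] by simp
qed (simp add: Cn_const)

lemma Cn_iter_int: "Cn n f \<Longrightarrow> Cn (n + q) (J q f)"
proof (induction q)
  case (Suc q)
  then show ?case
    using iter_int_deriv[OF Cn_continuous] by (auto intro!: Cn_SucI[of _ "J q f"])
qed simp

lemma Cn_funpow_deriv: "Cn n f \<Longrightarrow> q \<le> n \<Longrightarrow> Cn (n - q) ((deriv ^^ q) f)"
proof (induction q arbitrary: n f)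
  case (Suc q)
  then obtain n' where "n = Suc n'" by (cases n) auto
  then show ?case using Suc.IH[of n' "deriv f"] Suc.prems by (simp add: Cn_Suc funpow_swap1)
qed simp

text \<open>
An \<open>n\<close>-fold antiderivative on \<open>S\<close> is determined up to polynomials of degree less than \<open>n\<close>. Comparing
functions modulo such polynomials spares the bookkeeping of the boundary terms at \<open>c\<close>.
\<close>

definition poly_below :: "nat \<Rightarrow> (real \<Rightarrow> real) \<Rightarrow> bool" where
  "poly_below n f \<longleftrightarrow> (\<exists>k. \<forall>x\<in>S. f x = (\<Sum>i<n. k i * x ^ i))"

lemma poly_below_cong: "(\<And>x. x \<in> S \<Longrightarrow> f x = g x) \<Longrightarrow> poly_below n f \<Longrightarrow> poly_below n g"
  by (auto simp: poly_below_def)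

lemma poly_below_zero: "(\<And>x. x \<in> S \<Longrightarrow> f x = 0) \<Longrightarrow> poly_below n f"
  unfolding poly_below_def by (intro exI[of _ "\<lambda>_. 0"]) auto

lemma poly_below_lincomb:
  assumes "poly_below n f" "poly_below n g"
  shows "poly_below n (\<lambda>x. u * f x + v * g x)"
proof -
  obtain k l where "\<forall>x\<in>S. f x = (\<Sum>i<n. k i * x ^ i)" "\<forall>x\<in>S. g x = (\<Sum>i<n. l i * x ^ i)"
    using assms by (auto simp: poly_below_def)
  then have "\<forall>x\<in>S. u * f x + v * g x = (\<Sum>i<n. (u * k i + v * l i) * x ^ i)"
    by (simp add: sum_distrib_left sum.distrib algebra_simps)
  then show ?thesis
    unfolding poly_below_def by (intro exI[of _ "\<lambda>i. u * k i + v * l i"])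
qed

lemma poly_below_add: "poly_below n f \<Longrightarrow> poly_below n g \<Longrightarrow> poly_below n (\<lambda>x. f x + g x)"
  using poly_below_lincomb[of n f g 1 1] by simp

lemma poly_below_diff: "poly_below n f \<Longrightarrow> poly_below n g \<Longrightarrow> poly_below n (\<lambda>x. f x - g x)"
  using poly_below_lincomb[of n f g 1 "-1"] by simp

lemma poly_below_sum:
  "(\<And>i. i \<in> A \<Longrightarrow> poly_below n (f i)) \<Longrightarrow> poly_below n (\<lambda>x. \<Sum>i\<in>A. f i x)"
  by (induction A rule: infinite_finite_induct) (auto intro: poly_below_add poly_below_zero)

lemma poly_below_mono:
  assumes "poly_below n f" "n \<le> n'"
  shows "poly_below n' f"
proof -
  obtain k where k: "\<forall>x\<in>S. f x = (\<Sum>i<n. k i * x ^ i)"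
    using assms by (auto simp: poly_below_def)
  have "(\<Sum>i<n'. (if i < n then k i else 0) * x ^ i) = (\<Sum>i<n. k i * x ^ i)" for x
    using assms(2) by (intro sum.mono_neutral_cong_right) auto
  then show ?thesis using k unfolding poly_below_def
    by (intro exI[of _ "\<lambda>i. if i < n then k i else 0"]) simp
qed

lemma poly_below_antideriv:
  assumes "poly_below n f'" "\<And>x. x \<in> S \<Longrightarrow> (f has_real_derivative f' x) (at x)"
  shows "poly_below (Suc n) f"
proof -
  obtain k where k: "\<And>x. x \<in> S \<Longrightarrow> f' x = (\<Sum>i<n. k i * x ^ i)"
    using assms by (auto simp: poly_below_def)
  let ?p = "\<lambda>x. \<Sum>i<n. k i / real (Suc i) * x ^ Suc i"
  let ?l = "\<lambda>i. case i of 0 \<Rightarrow> f c - ?p c | Suc i' \<Rightarrow> k i' / real (Suc i')"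
  have "f x = (f c - ?p c) + ?p x" if "x \<in> S" for x
  proof (rule eq_on_if_same_deriv[OF assms(2) _ _ that])
    fix x assume x: "x \<in> S"
    have "((\<lambda>x. k i / real (Suc i) * x ^ Suc i) has_real_derivative k i * x ^ i) (at x)" for i
      using DERIV_cmult[OF DERIV_pow[of "Suc i" x UNIV], of "k i / real (Suc i)"]
      by (simp del: power_Suc of_nat_Suc)
    from DERIV_add[OF DERIV_const[of "f c - ?p c"] DERIV_sum[of "{..<n}", OF this]]
    show "((\<lambda>x. (f c - ?p c) + ?p x) has_real_derivative f' x) (at x)"
      using k[OF x] by simp
  qed auto
  then have "\<forall>x\<in>S. f x = (\<Sum>i<Suc n. ?l i * x ^ i)"
    by (simp add: sum.lessThan_Suc_shift del: sum.lessThan_Suc)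
  then show ?thesis
    unfolding poly_below_def by (intro exI[of _ ?l])
qed

lemma poly_below_deriv:
  assumes "poly_below (Suc n) f" "\<And>x. x \<in> S \<Longrightarrow> (f has_real_derivative f' x) (at x)"
  shows "poly_below n f'"
proof -
  obtain k where k: "\<And>x. x \<in> S \<Longrightarrow> f x = (\<Sum>i<Suc n. k i * x ^ i)"
    using assms by (auto simp: poly_below_def)
  have "f' x = (\<Sum>i<n. (k (Suc i) * real (Suc i)) * x ^ i)" if x: "x \<in> S" for x
  proof -
    have "((\<lambda>x. x ^ Suc i) has_real_derivative real (Suc i) * x ^ i) (at x)" for i
      using DERIV_pow[of "Suc i" x UNIV] by simp
    then have "((\<lambda>x. k 0 + (\<Sum>i<n. k (Suc i) * x ^ Suc i)) has_real_derivative
        0 + (\<Sum>i<n. k (Suc i) * (real (Suc i) * x ^ i))) (at x)"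
      by (intro DERIV_add DERIV_const DERIV_sum DERIV_cmult)
    then have "(f has_real_derivative 0 + (\<Sum>i<n. k (Suc i) * (real (Suc i) * x ^ i))) (at x)"
      by (rule has_field_derivative_transform_within_open[OF _ open_S x])
        (simp add: k sum.lessThan_Suc_shift del: sum.lessThan_Suc)
    from DERIV_unique[OF assms(2)[OF x] this] show ?thesis by (simp add: mult.assoc)
  qed
  then show ?thesis
    unfolding poly_below_def by (intro exI[of _ "\<lambda>i. k (Suc i) * real (Suc i)"] ballI)
qed

lemma poly_below_iter_int:
  assumes "continuous_on S f" "poly_below n f"
  shows "poly_below (n + q) (J q f)"
proof (induction q)
  case (Suc q)
  then show ?case using poly_below_antideriv[OF Suc iter_int_deriv[OF assms(1)]] by simp
qed (use assms in simp)

lemma poly_below_iter_int_diff: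
  assumes "continuous_on S f" "continuous_on S g" "poly_below n (\<lambda>x. f x - g x)"
  shows "poly_below (n + q) (\<lambda>x. J q f x - J q g x)"
proof (rule poly_below_cong)
  show "J q (\<lambda>x. f x - g x) x = J q f x - J q g x" if "x \<in> S" for x
    using iter_int_lincomb[OF assms(1,2) that, of q 1 "-1"] by simp
  show "poly_below (n + q) (J q (\<lambda>x. f x - g x))"
    using assms by (intro poly_below_iter_int continuous_intros)
qed

text \<open>
This recovers a differential equation from its integrated form: differentiate \<open>n\<close> times.
\<close>

lemma iter_int_poly_below_eq_0:
  assumes "continuous_on S g" "poly_below n (J n g)" "x \<in> S"
  shows "g x = 0"
  using assms(2)
proof (induction n)
  case (Suc n)
  then show ?case using poly_below_deriv[OF Suc.prems iter_int_deriv[OF assms(1)]] by blast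
qed (use assms in \<open>simp add: poly_below_def\<close>)

lemma iter_int_funpow_deriv:
  assumes "Cn n f"
  shows "poly_below n (\<lambda>x. f x - J n ((deriv ^^ n) f) x)"
  using assms
proof (induction n arbitrary: f)
  case (Suc n)
  have c: "continuous_on S ((deriv ^^ Suc n) f)"
    using Suc.prems by (simp add: times_cont_differentiable_on_def)
  show ?case
  proof (rule poly_below_antideriv)
    show "poly_below n (\<lambda>x. deriv f x - J n ((deriv ^^ n) (deriv f)) x)"
      using Suc by (simp add: Cn_Suc)
    show "((\<lambda>x. f x - J (Suc n) ((deriv ^^ Suc n) f) x) has_real_derivative
      deriv f x - J n ((deriv ^^ n) (deriv f)) x) (at x)" if "x \<in> S" for x
      using DERIV_diff[OF has_deriv iter_int_deriv[OF c that, of n], of f] Suc.prems that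
      by (simp add: Cn_Suc funpow_swap1)
  qed
qed (auto intro: poly_below_zero)

text \<open>
The induction integrates \<open>(f * Y\<^sup>(\<^sup>n\<^sup>))' = f * Y\<^sup>(\<^sup>n\<^sup>+\<^sup>1\<^sup>) + f' * Y\<^sup>(\<^sup>n\<^sup>)\<close> and applies the hypothesis
to \<open>f\<close> and to \<open>f'\<close>; the coefficients combine by the Pascal rule.
\<close>

lemma repeated_integration_by_parts:
  assumes "Cn n f" "Cn n Y"
  shows "poly_below n (\<lambda>x. J n (\<lambda>t. f t * (deriv ^^ n) Y t) x
    - (\<Sum>s\<le>n. (-1) ^ s * real (n choose s) * J s (\<lambda>t. (deriv ^^ s) f t * Y t) x))"
  using assms
proof (induction n arbitrary: f)
  case 0
  show ?case by (rule poly_below_zero) simp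
next
  case (Suc n)
  let ?F = "\<lambda>t. f t * (deriv ^^ n) Y t" and ?G = "\<lambda>t. deriv f t * (deriv ^^ n) Y t"
  let ?H = "\<lambda>t. f t * (deriv ^^ Suc n) Y t"
  let ?A = "\<lambda>s. J s (\<lambda>t. (deriv ^^ s) f t * Y t)"
  let ?c = "\<lambda>s. (-1) ^ s * real (n choose s)"
  have Y: "(deriv ^^ n) Y differentiable_on S" "Cn 0 ((deriv ^^ Suc n) Y)" "Cn 0 ((deriv ^^ n) Y)"
    using Cn_funpow_deriv[OF Suc.prems(2), of n] Cn_funpow_deriv[OF Suc.prems(2), of "Suc n"]
      Cn_funpow_deriv[OF Cn_Suc_D[OF Suc.prems(2)], of n] by (simp_all add: Cn_Suc)
  have f: "f differentiable_on S" "Cn n (deriv f)" "continuous_on S f" "continuous_on S (deriv f)"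
    using Suc.prems(1) Cn_continuous[OF Suc.prems(1)] Cn_continuous[of n "deriv f"] by (auto simp: Cn_Suc)
  have cont: "continuous_on S ?F" "continuous_on S ?G" "continuous_on S ?H"
    using Y f by (auto intro!: continuous_intros)
  have A: "continuous_on S (\<lambda>t. (deriv ^^ s) f t * Y t)" if "s \<le> Suc n" for s
    using Cn_continuous[OF Cn_funpow_deriv[OF Suc.prems(1) that]] Cn_continuous[OF Suc.prems(2)]
    by (intro continuous_intros)
  have by_parts: "J 1 ?H x = ?F x - (?F c + J 1 ?G x)" if "x \<in> S" for x
  proof (rule eq_on_if_same_deriv[OF _ _ _ that])
    fix x assume x: "x \<in> S"
    show "(J 1 ?H has_real_derivative ?H x) (at x)"
      using iter_int_deriv[OF cont(3) x, of 0] by simp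
    show "((\<lambda>x. ?F x - (?F c + J 1 ?G x)) has_real_derivative ?H x) (at x)"
      using DERIV_diff[OF DERIV_mult[OF has_deriv[OF f(1) x] has_deriv[OF Y(1) x]]
        DERIV_add[OF DERIV_const[of "?F c"] iter_int_deriv[OF cont(2) x, of 0]]]
      by (simp add: algebra_simps)
  qed simp
  have H: "J (Suc n) ?H x = J n ?F x - (J n (\<lambda>_. ?F c) x + J (Suc n) ?G x)" if x: "x \<in> S" for x
  proof -
    have c1: "continuous_on S (J 1 ?G)" by (rule iter_int_continuous[OF cont(2)])
    have "J (Suc n) ?H x = J n (J 1 ?H) x" by (simp add: iter_int_add)
    also have "\<dots> = J n (\<lambda>x. 1 * ?F x + (-1) * (1 * ?F c + 1 * J 1 ?G x)) x"
      using by_parts by (intro iter_int_cong iter_int_continuous cont x) simp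
    also have "\<dots> = 1 * J n ?F x + (-1) * J n (\<lambda>x. 1 * ?F c + 1 * J 1 ?G x) x"
      using c1 by (intro iter_int_lincomb x cont continuous_intros)
    also have "J n (\<lambda>x. 1 * ?F c + 1 * J 1 ?G x) x = 1 * J n (\<lambda>_. ?F c) x + 1 * J n (J 1 ?G) x"
      using c1 by (intro iter_int_lincomb x continuous_intros)
    finally show ?thesis by (simp add: iter_int_add)
  qed
  have 1: "poly_below (Suc n) (\<lambda>x. J n ?F x - (\<Sum>s\<le>n. ?c s * ?A s x))"
    using Suc.IH[OF Cn_Suc_D Cn_Suc_D, OF Suc.prems] by (rule poly_below_mono) simp
  have 2: "poly_below (Suc n) (J n (\<lambda>_. ?F c))"
  proof -
    have "poly_below 1 (\<lambda>_. ?F c)"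
      unfolding poly_below_def by (intro exI[of _ "\<lambda>_. ?F c"]) simp
    then show ?thesis using poly_below_iter_int[of "\<lambda>_. ?F c" 1 n] by simp
  qed
  have 3: "poly_below (Suc n) (\<lambda>x. J (Suc n) ?G x - (\<Sum>s\<le>n. ?c s * ?A (Suc s) x))"
  proof (rule poly_below_cong)
    let ?R = "\<lambda>x. \<Sum>s\<le>n. ?c s * J s (\<lambda>t. (deriv ^^ s) (deriv f) t * Y t) x"
    have D: "(deriv ^^ s) (deriv f) = (deriv ^^ Suc s) f" for s by (simp add: funpow_swap1)
    have "continuous_on S ?R"
      unfolding D by (intro continuous_intros iter_int_continuous A) auto
    then show "poly_below (Suc n) (\<lambda>x. J 1 (J n ?G) x - J 1 ?R x)"
      using poly_below_iter_int_diff[OF iter_int_continuous[OF cont(2)] _ Suc.IH[OF f(2) Cn_Suc_D[OF Suc.prems(2)]], of 1]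
      by simp
    show "J 1 (J n ?G) x - J 1 ?R x = J (Suc n) ?G x - (\<Sum>s\<le>n. ?c s * ?A (Suc s) x)" if "x \<in> S" for x
    proof -
      have "J 1 ?R x = (\<Sum>s\<le>n. ?c s * J 1 (J s (\<lambda>t. (deriv ^^ s) (deriv f) t * Y t)) x)"
        unfolding D by (intro iter_int_sum iter_int_continuous A that) auto
      then show ?thesis unfolding D iter_int_add by simp
    qed
  qed
  have pascal: "(\<Sum>s\<le>Suc n. (-1) ^ s * real (Suc n choose s) * ?A s x)
      = (\<Sum>s\<le>n. ?c s * ?A s x) - (\<Sum>s\<le>n. ?c s * ?A (Suc s) x)" for x
  proof -
    have "(\<Sum>s\<le>Suc n. (-1) ^ s * real (Suc n choose s) * ?A s x)
        = ?A 0 x + (\<Sum>s\<le>n. ?c (Suc s) * ?A (Suc s) x - ?c s * ?A (Suc s) x)"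
    proof -
      have "(-1) ^ Suc s * real (Suc n choose Suc s) * X = ?c (Suc s) * X - ?c s * X" for s and X :: real
        by (simp add: algebra_simps)
      then show ?thesis unfolding sum.atMost_Suc_shift by simp
    qed
    also have "\<dots> = (\<Sum>s\<le>Suc n. ?c s * ?A s x) - (\<Sum>s\<le>n. ?c s * ?A (Suc s) x)"
      unfolding sum.atMost_Suc_shift by (simp add: sum_subtractf)
    finally show ?thesis by (simp add: binomial_eq_0)
  qed
  show ?case
  proof (rule poly_below_cong[OF _ poly_below_diff[OF poly_below_diff[OF 1 2] 3]])
    fix x assume x: "x \<in> S"
    have rearrange: "u - v - p - (g - w) = u - (p + g) - (v - w)" for u v p g w :: real by simp
    show "J n ?F x - (\<Sum>s\<le>n. ?c s * ?A s x) - J n (\<lambda>_. ?F c) x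
        - (J (Suc n) ?G x - (\<Sum>s\<le>n. ?c s * ?A (Suc s) x))
      = J (Suc n) ?H x - (\<Sum>s\<le>Suc n. (-1) ^ s * real (Suc n choose s) * ?A s x)"
      unfolding H[OF x] pascal by (rule rearrange)
  qed
qed

end

section \<open>The solution space\<close>

locale smooth_ode = base_interval +
  fixes m :: nat and a :: "nat \<Rightarrow> real \<Rightarrow> real"
  assumes m_pos: "m \<ge> 1" and a_smooth: "p \<in> {1..m} \<Longrightarrow> Cn (m - p) (a p)"
begin

text \<open>
In \<open>b\<^sub>k\<close> the function \<open>a\<^sub>i\<close>, which is \<open>m - i\<close> times differentiable, is differentiated \<open>k - i\<close>
times. This leaves \<open>m - k\<close> derivatives for every \<open>i\<close>.
\<close>

lemma b_coeff_smooth: "k \<in> {1..m} \<Longrightarrow> Cn (m - k) (b_coeff m a k)"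
proof -
  assume k: "k \<in> {1..m}"
  have "Cn (m - k) (\<lambda>x. (-1) ^ i * real ((m - i) choose (m - k)) * (deriv ^^ (k - i)) (a i) x)"
    if i: "i \<in> {1..k}" for i
  proof -
    have "Cn (m - i - (k - i)) ((deriv ^^ (k - i)) (a i))"
      using i k by (intro Cn_funpow_deriv a_smooth) auto
    then have "Cn (m - k) ((deriv ^^ (k - i)) (a i))" using i k by simp
    then show ?thesis by (intro Cn_mult Cn_const)
  qed
  then show ?thesis
    unfolding b_coeff_def[abs_def] by (rule Cn_sum)
qed

end

sublocale smooth_ode \<subseteq> ode_coefficients S c m a
  by unfold_locales (use b_coeff_smooth Cn_continuous in blast)

context smooth_ode begin

lemma volterra_eq_sum_by_parts:
  assumes Y: "continuous_on S Y" and x: "x \<in> S"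
  shows "volterra Y x = (\<Sum>p=1..m. \<Sum>s\<le>m - p. (-1) ^ s * real ((m - p) choose s)
     * J (p + s) (\<lambda>t. (deriv ^^ s) (a p) t * Y t) x)"
proof -
  let ?f = "\<lambda>k i. (-1) ^ (k + i) * real ((m - i) choose (m - k)) * J k (\<lambda>t. (deriv ^^ (k - i)) (a i) t * Y t) x"
  have "volterra Y x = (\<Sum>k=1..m. \<Sum>i=1..k. ?f k i)"
    unfolding volterra_def
  proof (rule sum.cong[OF refl])
    fix k assume k: "k \<in> {1..m}"
    let ?w = "\<lambda>i. (-1) ^ i * real ((m - i) choose (m - k))"
    have "J k (\<lambda>t. b_coeff m a k t * Y t) x
        = J k (\<lambda>t. \<Sum>i=1..k. ?w i * ((deriv ^^ (k - i)) (a i) t * Y t)) x"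
      by (simp add: b_coeff_def sum_distrib_right mult.assoc)
    also have "\<dots> = (\<Sum>i=1..k. ?w i * J k (\<lambda>t. (deriv ^^ (k - i)) (a i) t * Y t) x)"
    proof (rule iter_int_sum[OF _ x])
      fix i assume "i \<in> {1..k}"
      then have "continuous_on S ((deriv ^^ (k - i)) (a i))"
        using k by (intro Cn_continuous[OF Cn_funpow_deriv[OF a_smooth]]) auto
      then show "continuous_on S (\<lambda>t. (deriv ^^ (k - i)) (a i) t * Y t)"
        using Y by (intro continuous_intros)
    qed
    finally show "(-1) ^ k * J k (\<lambda>t. b_coeff m a k t * Y t) x = (\<Sum>i=1..k. ?f k i)"
      by (simp add: sum_distrib_left power_add mult.assoc)
  qed
  also have "\<dots> = (\<Sum>(k, i)\<in>(SIGMA k:{1..m}. {1..k}). ?f k i)"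
    by (subst sum.Sigma) auto
  also have "\<dots> = (\<Sum>(p, s)\<in>(SIGMA p:{1..m}. {..m - p}). ?f (p + s) p)"
    by (rule sum.reindex_bij_witness[of _ "\<lambda>(p, s). (p + s, p)" "\<lambda>(k, i). (i, k - i)"]) auto
  also have "\<dots> = (\<Sum>p=1..m. \<Sum>s\<le>m - p. ?f (p + s) p)"
    by (subst sum.Sigma) auto
  also have "\<dots> = (\<Sum>p=1..m. \<Sum>s\<le>m - p. (-1) ^ s * real ((m - p) choose s)
     * J (p + s) (\<lambda>t. (deriv ^^ s) (a p) t * Y t) x)"
  proof (intro sum.cong refl)
    fix p s assume "p \<in> {1..m}" "s \<in> {..m - p}"
    then have "(m - p) choose (m - (p + s)) = (m - p) choose s"
      using binomial_symmetric[of s "m - p"] by simp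
    moreover have "(-1 :: real) ^ (p + s + p) = (-1) ^ s"
      by (simp add: power_add)
    ultimately show "?f (p + s) p = (-1) ^ s * real ((m - p) choose s)
     * J (p + s) (\<lambda>t. (deriv ^^ s) (a p) t * Y t) x" by simp
  qed
  finally show ?thesis .
qed

definition rhs :: "(real \<Rightarrow> real) \<Rightarrow> real \<Rightarrow> real" where
  "rhs Y x = (\<Sum>p=1..m. a p x * (deriv ^^ (m - p)) Y x)"

lemma term_continuous:
  assumes "Cn m Y" "p \<in> {1..m}"
  shows "continuous_on S (\<lambda>x. a p x * (deriv ^^ (m - p)) Y x)"
  using Cn_continuous[OF a_smooth[OF assms(2)]] Cn_continuous[OF Cn_funpow_deriv[OF assms(1), of "m - p"]]
  by (auto intro: continuous_intros)

lemma rhs_continuous: "Cn m Y \<Longrightarrow> continuous_on S (rhs Y)"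
  unfolding rhs_def[abs_def] by (intro continuous_on_sum term_continuous)

text \<open>
In \<open>J m (a\<^sub>p * Y\<^sup>(\<^sup>m\<^sup>-\<^sup>p\<^sup>))\<close> the inner \<open>m - p\<close> integrations remove the derivatives of \<open>Y\<close>; the
coefficients of \<open>b_coeff\<close> are those that the integrations by parts produce for \<open>k = p + s\<close>.
\<close>

lemma iter_int_rhs:
  assumes Y: "Cn m Y"
  shows "poly_below m (\<lambda>x. J m (rhs Y) x - volterra Y x)"
proof -
  let ?H = "\<lambda>p t. a p t * (deriv ^^ (m - p)) Y t"
  let ?A = "\<lambda>p s t. (deriv ^^ s) (a p) t * Y t"
  let ?R = "\<lambda>p x. \<Sum>s\<le>m - p. (-1) ^ s * real ((m - p) choose s) * J s (?A p s) x"
  have A: "continuous_on S (?A p s)" if "p \<in> {1..m}" "s \<le> m - p" for p s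
    using Cn_continuous[OF Cn_funpow_deriv[OF a_smooth]] Cn_continuous[OF Y] that
    by (auto intro!: continuous_intros)
  have "poly_below m (\<lambda>x. J m (?H p) x - J p (?R p) x)" if p: "p \<in> {1..m}" for p
  proof -
    have "poly_below (m - p) (\<lambda>x. J (m - p) (?H p) x - ?R p x)"
      using Cn_mono[OF _ Y, of "m - p"] by (intro repeated_integration_by_parts a_smooth p) auto
    moreover have "continuous_on S (?R p)"
      using A p by (intro continuous_on_sum continuous_on_mult_left iter_int_continuous) auto
    ultimately have "poly_below (m - p + p) (\<lambda>x. J p (J (m - p) (?H p)) x - J p (?R p) x)"
      using term_continuous[OF Y p] by (intro poly_below_iter_int_diff iter_int_continuous)
    then show ?thesis using p by (simp add: iter_int_add)
  qed
  then have "poly_below m (\<lambda>x. \<Sum>p=1..m. J m (?H p) x - J p (?R p) x)"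
    by (rule poly_below_sum)
  then show ?thesis
  proof (rule poly_below_cong[rotated])
    fix x assume x: "x \<in> S"
    have "J m (rhs Y) x = J m (\<lambda>t. \<Sum>p=1..m. 1 * ?H p t) x"
      by (simp add: rhs_def[abs_def])
    also have "\<dots> = (\<Sum>p=1..m. 1 * J m (?H p) x)"
      using term_continuous[OF Y] by (intro iter_int_sum x)
    finally have 1: "J m (rhs Y) x = (\<Sum>p=1..m. J m (?H p) x)" by simp
    have 2: "J p (?R p) x = (\<Sum>s\<le>m - p. (-1) ^ s * real ((m - p) choose s) * J (p + s) (?A p s) x)"
      if p: "p \<in> {1..m}" for p
    proof -
      have "J p (?R p) x = (\<Sum>s\<le>m - p. (-1) ^ s * real ((m - p) choose s) * J p (J s (?A p s)) x)"
        using A p by (intro iter_int_sum iter_int_continuous x) auto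
      then show ?thesis by (simp add: iter_int_add)
    qed
    have "volterra Y x = (\<Sum>p=1..m. J p (?R p) x)"
      unfolding volterra_eq_sum_by_parts[OF Cn_continuous[OF Y] x] by (intro sum.cong refl 2[symmetric])
    then show "(\<Sum>p=1..m. J m (?H p) x - J p (?R p) x) = J m (rhs Y) x - volterra Y x"
      unfolding 1 sum_subtractf by simp
  qed
qed

lemma is_solution_iff:
  "is_solution m a S Y \<longleftrightarrow> Cn m Y \<and> (\<forall>x\<in>S. (deriv ^^ m) Y x = rhs Y x)"
proof
  assume Y: "is_solution m a S Y"
  then have d: "(deriv ^^ q) Y differentiable_on S" if "q < m" for q
    using that by (auto simp: is_solution_def times_differentiable_on_def)
  have "continuous_on S (rhs Y)"
    unfolding rhs_def[abs_def]
    using Cn_continuous[OF a_smooth] d m_pos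
    by (intro continuous_intros) (auto intro!: differentiable_imp_continuous_on)
  then have "continuous_on S ((deriv ^^ m) Y)"
    using Y by (subst continuous_on_cong[OF refl]) (auto simp: is_solution_def rhs_def)
  then show "Cn m Y \<and> (\<forall>x\<in>S. (deriv ^^ m) Y x = rhs Y x)"
    using Y by (auto simp: is_solution_def times_cont_differentiable_on_def rhs_def)
qed (auto simp: is_solution_def times_cont_differentiable_on_def rhs_def)

text \<open>
Bootstrapping: if \<open>Y\<close> has \<open>l\<close> derivatives, then \<open>b\<^sub>k Y\<close> has \<open>min l (m - k)\<close> and its \<open>k\<close>-fold integral
has \<open>min (l + k) m\<close>, which exceeds \<open>l\<close> as long as \<open>l < m\<close>.
\<close>

lemma volterra_smooth:
  assumes Y: "continuous_on S Y" and P: "poly_below m (\<lambda>x. Y x - volterra Y x)"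
  shows "Cn m Y"
proof -
  have "Cn l Y" if "l \<le> m" for l
    using that
  proof (induction l)
    case (Suc l)
    obtain k where k: "\<And>x. x \<in> S \<Longrightarrow> Y x - volterra Y x = (\<Sum>i<m. k i * x ^ i)"
      using P by (auto simp: poly_below_def)
    have "Cn (Suc l) (\<lambda>x. (-1) ^ p * J p (\<lambda>t. b_coeff m a p t * Y t) x)" if p: "p \<in> {1..m}" for p
    proof -
      have "Cn (min l (m - p)) (\<lambda>t. b_coeff m a p t * Y t)"
        using Cn_mono[OF _ Suc.IH] Cn_mono[OF _ b_coeff_smooth[OF p]] Suc.prems by (intro Cn_mult) auto
      from Cn_iter_int[OF this, of p] have "Cn (Suc l) (J p (\<lambda>t. b_coeff m a p t * Y t))"
        using p Suc.prems by (intro Cn_mono[of "Suc l" "min l (m - p) + p"]) auto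
      then show ?thesis by (intro Cn_mult Cn_const)
    qed
    then have "Cn (Suc l) (volterra Y)"
      unfolding volterra_def[abs_def] by (rule Cn_sum)
    moreover have "Cn (Suc l) (\<lambda>x. \<Sum>i<m. k i * x ^ i)"
      by (intro Cn_sum Cn_mult Cn_const Cn_power)
    ultimately have "Cn (Suc l) (\<lambda>x. (\<Sum>i<m. k i * x ^ i) + volterra Y x)"
      by (rule Cn_add[rotated])
    then show ?case using Cn_cong[of "\<lambda>x. (\<Sum>i<m. k i * x ^ i) + volterra Y x" Y] k by (simp add: algebra_simps)
  qed (use Y in simp)
  then show ?thesis by simp
qed

lemma is_solution_iff_volterra:
  "is_solution m a S Y \<longleftrightarrow> continuous_on S Y \<and> poly_below m (\<lambda>x. Y x - volterra Y x)"
proof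
  assume Y: "is_solution m a S Y"
  then have Cn: "Cn m Y" and eq: "\<And>x. x \<in> S \<Longrightarrow> (deriv ^^ m) Y x = rhs Y x"
    by (auto simp: is_solution_iff)
  have "J m ((deriv ^^ m) Y) x = J m (rhs Y) x" if "x \<in> S" for x
    using iter_int_cong[OF rhs_continuous[OF Cn] eq[symmetric] that] by simp
  then have "poly_below m (\<lambda>x. Y x - volterra Y x)"
    by (intro poly_below_cong[OF _ poly_below_add[OF iter_int_funpow_deriv[OF Cn] iter_int_rhs[OF Cn]]]) simp
  then show "continuous_on S Y \<and> poly_below m (\<lambda>x. Y x - volterra Y x)"
    using Cn_continuous[OF Cn] by simp
next
  assume Y: "continuous_on S Y \<and> poly_below m (\<lambda>x. Y x - volterra Y x)"
  then have Cn: "Cn m Y" by (auto intro: volterra_smooth)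
  let ?g = "\<lambda>x. (deriv ^^ m) Y x - rhs Y x"
  have c: "continuous_on S ((deriv ^^ m) Y)"
    using Cn by (simp add: times_cont_differentiable_on_def)
  have g: "continuous_on S ?g" by (intro continuous_intros c rhs_continuous Cn)
  have "poly_below m (\<lambda>x. (Y x - volterra Y x) - (Y x - J m ((deriv ^^ m) Y) x) - (J m (rhs Y) x - volterra Y x))"
    by (rule poly_below_diff[OF poly_below_diff[OF conjunct2[OF Y] iter_int_funpow_deriv[OF Cn]] iter_int_rhs[OF Cn]])
  then have "poly_below m (J m ?g)"
    using iter_int_lincomb[OF c rhs_continuous[OF Cn], of _ m 1 "-1"]
    by (elim poly_below_cong[rotated]) simp
  from iter_int_poly_below_eq_0[OF g this] show "is_solution m a S Y"
    using Cn by (simp add: is_solution_iff)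
qed

lemma poly_below_iff_taylor:
  "poly_below m f \<longleftrightarrow> (\<exists>k. \<forall>x\<in>S. f x = (\<Sum>q=1..m. k q * taylor (- x) q 1))"
proof -
  have *: "(\<Sum>q=1..m. k q * taylor (- x) q 1) = (\<Sum>i<m. (k (Suc i) * (-1) ^ i / fact i) * x ^ i)" for k x
    by (rule sum.reindex_bij_witness[of _ Suc "\<lambda>q. q - 1"])
      (auto simp: taylor_def power_minus[of x])
  show ?thesis
  proof
    assume "poly_below m f"
    then obtain k where k: "\<And>x. x \<in> S \<Longrightarrow> f x = (\<Sum>i<m. k i * x ^ i)" by (auto simp: poly_below_def)
    have "f x = (\<Sum>q=1..m. (k (q - 1) * (-1) ^ (q - 1) * fact (q - 1)) * taylor (- x) q 1)" if "x \<in> S" for x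
      unfolding * k[OF that] by (intro sum.cong refl) (simp add: power_mult_distrib[symmetric])
    then show "\<exists>k. \<forall>x\<in>S. f x = (\<Sum>q=1..m. k q * taylor (- x) q 1)" by (intro exI ballI)
  next
    assume "\<exists>k. \<forall>x\<in>S. f x = (\<Sum>q=1..m. k q * taylor (- x) q 1)"
    then show "poly_below m f" unfolding * poly_below_def by (elim exE) (rule exI)
  qed
qed

lemma solution_space:
  "is_solution m a S Y \<longleftrightarrow> (\<exists>k. \<forall>x\<in>S. Y x = (\<Sum>q=1..m. k q * neumann q x))"
proof
  assume "is_solution m a S Y"
  then have Y: "continuous_on S Y" and "poly_below m (\<lambda>x. Y x - volterra Y x)"
    by (auto simp: is_solution_iff_volterra)
  then obtain k where "\<forall>x\<in>S. Y x - volterra Y x = (\<Sum>q=1..m. k q * taylor (- x) q 1)"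
    by (auto simp: poly_below_iff_taylor)
  then have "\<forall>x\<in>S. Y x = (\<Sum>q=1..m. k q * taylor (- x) q 1) + volterra Y x"
    by (simp add: algebra_simps)
  then show "\<exists>k. \<forall>x\<in>S. Y x = (\<Sum>q=1..m. k q * neumann q x)"
    using volterra_solutions[OF Y] by blast
next
  assume "\<exists>k. \<forall>x\<in>S. Y x = (\<Sum>q=1..m. k q * neumann q x)"
  then obtain k where k: "\<forall>x\<in>S. Y x = (\<Sum>q=1..m. k q * neumann q x)" by blast
  have "continuous_on S (\<lambda>x. \<Sum>q=1..m. k q * neumann q x)"
    by (intro continuous_intros neumann_continuous)
  then have Y: "continuous_on S Y" using k by (subst continuous_on_cong[OF refl]) auto
  have "\<forall>x\<in>S. Y x - volterra Y x = (\<Sum>q=1..m. k q * taylor (- x) q 1)"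
    using volterra_solutions[OF Y, of k] k by (simp add: algebra_simps)
  then show "is_solution m a S Y"
    using Y by (auto simp: is_solution_iff_volterra poly_below_iff_taylor)
qed

lemma y_eq_xi:
  assumes x: "x \<in> S" and q: "q \<in> {1..m}"
  shows "y q s x = (\<Sum>j=1..m. taylor (- x) q j *
     (case s of 0 \<Rightarrow> of_bool (j = 1) | Suc s' \<Rightarrow> - xi m a c s' j x))"
proof (rule y_eq_recursion[OF x q])
  show "xi m a c s n x = T s n 1 x - (\<Sum>z=1..s. \<Sum>j=1..m. T (z - 1) n j x * xi m a c (s - z) j x)"
    for n s
    using m_pos x by (subst xi.simps) (simp add: T_fun_eq_T)
qed

text \<open>
Inverting \<open>y_eq_xi\<close> shows that \<open>\<xi>\<close> inherits the geometric decay of the Neumann terms.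
\<close>

lemma xi_eq_y:
  assumes x: "x \<in> S" and n: "n \<in> {1..m}"
  shows "xi m a c s n x = - (\<Sum>q=1..m. taylor x n q * y q (Suc s) x)"
proof -
  have "(\<Sum>q=1..m. taylor x n q * y q (Suc s) x)
      = (\<Sum>q=1..m. \<Sum>j=1..m. taylor x n q * taylor (- x) q j * - xi m a c s j x)"
    by (intro sum.cong refl) (simp add: y_eq_xi[OF x] sum_distrib_left mult.assoc del: y.simps)
  also have "\<dots> = (\<Sum>j=1..m. (\<Sum>q=1..m. taylor x n q * taylor (- x) q j) * - xi m a c s j x)"
    unfolding sum_distrib_right by (rule sum.swap)
  also have "\<dots> = (\<Sum>j=1..m. if n = j then - xi m a c s j x else 0)"
    by (intro sum.cong refl) (subst taylor_add[OF n], auto simp: taylor_0)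
  also have "\<dots> = - xi m a c s n x" using n by simp
  finally show ?thesis by simp
qed

lemma xi_summable:
  assumes x: "x \<in> S" and n: "n \<in> {1..m}"
  shows "summable (\<lambda>s. xi m a c s n x)"
proof -
  have "summable (\<lambda>s. y q (Suc s) x)" for q
    using y_summable[OF x] by (subst summable_Suc_iff)
  then show ?thesis
    unfolding xi_eq_y[OF assms] by (intro summable_minus summable_sum summable_mult)
qed

lemma neumann_eq_alpha:
  assumes x: "x \<in> S" and q: "q \<in> {1..m}"
  shows "neumann q x = (\<Sum>j=1..m. taylor (- x) q j * (of_bool (j = 1) - alpha m a c j x))"
proof -
  let ?V = "\<lambda>j s. case s of 0 \<Rightarrow> of_bool (j = 1) | Suc s' \<Rightarrow> - xi m a c s' j x"
  have "?V j sums (of_bool (j = 1) - alpha m a c j x)" if j: "j \<in> {1..m}" for j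
  proof -
    have "(\<lambda>s. ?V j (Suc s)) sums (- alpha m a c j x)"
      using xi_summable[OF x j] by (auto simp: alpha_def intro: sums_minus summable_sums)
    then have "?V j sums (- alpha m a c j x + ?V j 0)" by (rule sums_Suc)
    then show ?thesis by simp
  qed
  then have "(\<lambda>s. y q s x) sums (\<Sum>j=1..m. taylor (- x) q j * (of_bool (j = 1) - alpha m a c j x))"
    unfolding y_eq_xi[OF assms] by (intro sums_sum sums_mult)
  then show ?thesis unfolding neumann_def by (rule sums_unique[symmetric])
qed

text \<open>
The coefficients in \<open>Y_sol\<close> are those of the inverse monomial Wronskian matrix \<open>taylor (- x)\<close>. The
first summand of \<open>Y_sol\<close> is the one with \<open>k = 1\<close>, where the entry of \<open>e\<^sub>1 - \<alpha>\<close> is \<open>1 - \<alpha>\<close> instead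
of \<open>- \<alpha>\<close>.
\<close>

lemma Y_sol_eq:
  assumes x: "x \<in> S" and i: "i \<in> {1..m}"
  shows "Y_sol m a c i x = - neumann i x"
proof -
  let ?v = "\<lambda>j. of_bool (j = 1) - alpha m a c j x"
  have t: "taylor (- x) i j = (-1) ^ (j + i) * x ^ (i - j) / fact (i - j)" if "j \<le> i" for j
  proof -
    have "j + i = (i - j) + 2 * j" using that by simp
    then have "(-1 :: real) ^ (j + i) = (-1) ^ (i - j)"
      by (simp only: power_add) simp
    then show ?thesis using that by (simp add: taylor_def power_minus[of x])
  qed
  have "neumann i x = (\<Sum>j=1..i. taylor (- x) i j * ?v j)"
    unfolding neumann_eq_alpha[OF assms] using i
    by (intro sum.mono_neutral_right) (auto simp: taylor_def)
  also have "\<dots> = taylor (- x) i 1 * ?v 1 + (\<Sum>j=2..i. taylor (- x) i j * ?v j)"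
    using i by (subst sum.atLeast_Suc_atMost) (auto simp: numeral_2_eq_2)
  also have "(\<Sum>j=2..i. taylor (- x) i j * ?v j)
      = - (\<Sum>k=2..i. (-1) ^ (k + i) * alpha m a c k x * x ^ (i - k) / fact (i - k))"
    unfolding sum_negf[symmetric] by (intro sum.cong refl) (simp add: t)
  also have "taylor (- x) i 1 * ?v 1 = - ((-1) ^ i * (1 - alpha m a c 1 x) * x ^ (i - 1) / fact (i - 1))"
    using i by (simp add: t)
  finally show ?thesis by (simp add: Y_sol_def)
qed

end

theorem mainTheorem3:
  fixes m :: nat and a :: "nat \<Rightarrow> real \<Rightarrow> real" and S :: "real set" and c :: real
  assumes "m \<ge> 1"
    and "open S" and "is_interval S" and "c \<in> S"
    and "\<And>p. p \<in> {1..m} \<Longrightarrow> times_cont_differentiable_on (m - p) (a p) S"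
  shows "(\<forall>n\<in>{1..m}. \<forall>x\<in>S. summable (\<lambda>s. xi m a c s n x)) \<and>
         (\<forall>Y. is_solution m a S Y \<longleftrightarrow>
            (\<exists>C :: nat \<Rightarrow> real. \<forall>x\<in>S. Y x = (\<Sum>i=1..m. C i * Y_sol m a c i x)))"
proof -
  interpret smooth_ode S c m a
    using assms by unfold_locales
  have "(\<exists>k. \<forall>x\<in>S. Y x = (\<Sum>i=1..m. k i * Y_sol m a c i x))
     \<longleftrightarrow> (\<exists>k. \<forall>x\<in>S. Y x = (\<Sum>q=1..m. k q * neumann q x))" for Y
  proof -
    have "(\<Sum>i=1..m. k i * Y_sol m a c i x) = (\<Sum>q=1..m. - k q * neumann q x)" if "x \<in> S" for k x
      using Y_sol_eq[OF that] by simp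
    then have *: "(\<forall>x\<in>S. Y x = (\<Sum>i=1..m. k i * Y_sol m a c i x))
       \<longleftrightarrow> (\<forall>x\<in>S. Y x = (\<Sum>q=1..m. - k q * neumann q x))" for k
      by simp
    show ?thesis
    proof
      assume "\<exists>k. \<forall>x\<in>S. Y x = (\<Sum>q=1..m. k q * neumann q x)"
      then obtain k where "\<forall>x\<in>S. Y x = (\<Sum>q=1..m. - (- k q) * neumann q x)" by auto
      then show "\<exists>k. \<forall>x\<in>S. Y x = (\<Sum>i=1..m. k i * Y_sol m a c i x)"
        unfolding *[symmetric] by (intro exI[of _ "\<lambda>i. - k i"])
    next
      assume "\<exists>k. \<forall>x\<in>S. Y x = (\<Sum>i=1..m. k i * Y_sol m a c i x)"
      then show "\<exists>k. \<forall>x\<in>S. Y x = (\<Sum>q=1..m. k q * neumann q x)"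
        unfolding * by (elim exE) (rule exI[of _ "\<lambda>i. - _ i"])
    qed
  qed
  then show ?thesis
    using xi_summable solution_space by simp
qed

end
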